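(* Let $G$ be a finite group, let $H \subseteq G$ be a subgroup, and suppose $H$ has a missing harmonic $\eta$, i.e. $\eta$ is an irreducible representation of $G$ with $\frac{1}{|H|}\sum_{h\in H}\eta(h)=0$. Let $k\ge 1$ be an integer with $k \ge \log_2 |G|$. Consider the following measurement on a state (density matrix) on $\mathbb{C}[G^k]$: first perform weak Fourier sampling, i.e. the projective measurement $\{P_{\boldsymbol{\sigma}}\}_{\boldsymbol{\sigma}\in\widehat{G}^k}$; upon outcome $\boldsymbol{\sigma}$, report "trivial" if the state is then observed in the subspace $W_{\eta,\boldsymbol{\sigma}}$, and "don't know" if it is observed in its orthogonal complement. Then: (a) if the hidden subgroup is a conjugate $H'=gHg^{-1}$ of $H$ ($g \in G$), the measurement applied to the $k$-register coset state $\boldsymbol{\rho}_{H'}$ reports "trivial" with probability $0$, i.e. $\sum_{\boldsymbol{\sigma}\in\widehat{G}^k} \operatorname{tr}\left(\Pi_{\eta,\boldsymbol{\sigma}}\,\boldsymbol{\rho}_{H'}\right)=0$; (b) if the hidden subgroup is the trivial subgroup $\{1\}$, the measurement applied to $\boldsymbol{\rho}_{\{1\}}$ reports "trivial" with probability at least $\frac12$, i.e. $\sum_{\boldsymbol{\sigma}\in\widehat{G}^k} \operatorname{tr}\left(\Pi_{\eta,\boldsymbol{\sigma}}\,\boldsymbol{\rho}_{\{1\}}\right)\ge\frac12$.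
   Context: All representations are finite-dimensional, complex and unitary; $\widehat{G}$ is the set of irreducible representations of $G$ up to isomorphism. $\mathbb{C}[G^k]=\mathbb{C}[G]^{\otimes k}$ is the Hilbert space with orthonormal basis $\{|\boldsymbol{x}\rangle : \boldsymbol{x}=(x_1,\dots,x_k)\in G^k\}$; $[k]=\{1,\dots,k\}$. Coset state: for a subgroup $K\subseteq G$, and $c \in G$, put $|cK\rangle=\frac{1}{\sqrt{|K|}}\sum_{h\in K}|ch\rangle$, $\rho_K=\frac{1}{|G|}\sum_{c\in G}|cK\rangle\langle cK|$, and $\boldsymbol{\rho}_K=\rho_K^{\otimes k}$, a density matrix on $\mathbb{C}[G^k]$. For $\boldsymbol{\sigma}=(\sigma_1,\dots,\sigma_k)\in\widehat{G}^k$, $P_{\boldsymbol{\sigma}}$ is the orthogonal projection of $\mathbb{C}[G^k]$ onto the isotypic component of the irreducible representation $\sigma_1\otimes\cdots\otimes\sigma_k$ of $G^k$, where $G^k$ acts by right multiplication: $\boldsymbol{g}\cdot|\boldsymbol{x}\rangle=|x_1g_1^{-1},\dots,x_kg_k^{-1}\rangle$. For nonempty $I\subseteq[k]$, let $G$ act on $\mathbb{C}[G^k]$ by diagonal right multiplication on the registers in $I$: $g$ sends $|\boldsymbol{x}\rangle$ to $|\boldsymbol{y}\rangle$ with $y_i=x_ig^{-1}$ for $i\in I$ and $y_i=x_i$ for $i\notin I$. Let $W^I_\eta$ be the isotypic component of $\eta$ (span of all subrepresentations isomorphic to $\eta$) under this action, and let $W^I_{\eta,\boldsymbol{\sigma}}=W^I_\eta\cap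 \operatorname{im}P_{\boldsymbol{\sigma}}$ (equivalently, inside each copy of $\sigma_1\otimes\cdots\otimes\sigma_k$, decompose $\bigotimes_{i\in I}\sigma_i$ into irreducibles of $G$ under the diagonal action, take the summands isomorphic to $\eta$, and tensor with $\bigotimes_{i\notin I}\sigma_i$). Let $W_{\eta,\boldsymbol{\sigma}}$ be the linear span of the $W^I_{\eta,\boldsymbol{\sigma}}$ over all nonempty $I\subseteq[k]$, and $\Pi_{\eta,\boldsymbol{\sigma}}$ the orthogonal projection of $\mathbb{C}[G^k]$ onto $W_{\eta,\boldsymbol{\sigma}}$. *)

theory Defs
  imports
    Complex_Main
    "HOL-Algebra.Product_Groups"
    "HOL-Library.Function_Algebras"
    "HOL-Library.Complex_Order"
begin

section \<open>Finite-dimensional Hilbert spaces with a distinguished orthonormal basis\<close>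

text \<open>
  The dimensions of the irreducible representations and of the \<open>k\<close>-register space vary within one
  statement, so they cannot be types. The Hilbert space with orthonormal basis indexed by a finite
  set \<open>X\<close> is therefore the space of complex functions vanishing outside \<open>X\<close>, inside the complex
  vector space of all functions on the index type.
\<close>

type_synonym 'x vect = "'x \<Rightarrow> complex"
type_synonym 'x oper = "'x vect \<Rightarrow> 'x vect"

definition cscale :: "complex \<Rightarrow> 'x vect \<Rightarrow> 'x vect" (infixr "*\<^sub>C" 75)
  where "c *\<^sub>C v = (\<lambda>x. c * v x)"

global_interpretation cvs: vector_space "cscale :: complex \<Rightarrow> 'x vect \<Rightarrow> 'x vect"
  by unfold_locales (auto simp: cscale_def plus_fun_def algebra_simps)

abbreviation clin :: "('x vect \<Rightarrow> 'y vect) \<Rightarrow> bool"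
  where "clin \<equiv> Vector_Spaces.linear cscale cscale"

definition hilb :: "'x set \<Rightarrow> 'x vect set"
  where "hilb X = {v. \<forall>x. x \<notin> X \<longrightarrow> v x = 0}"

definition ket :: "'x \<Rightarrow> 'x vect"
  where "ket x = (\<lambda>y. if y = x then 1 else 0)"

definition cinner :: "'x set \<Rightarrow> 'x vect \<Rightarrow> 'x vect \<Rightarrow> complex"
  where "cinner X u v = (\<Sum>x\<in>X. cnj (u x) * v x)"

definition ketbra :: "'x set \<Rightarrow> 'x vect \<Rightarrow> 'x vect \<Rightarrow> 'x oper"
  where "ketbra X u w = (\<lambda>v. cinner X w v *\<^sub>C u)"

definition op_trace :: "'x set \<Rightarrow> 'x oper \<Rightarrow> complex"
  where "op_trace X A = (\<Sum>x\<in>X. A (ket x) x)"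

definition orth_proj :: "'x set \<Rightarrow> 'x vect set \<Rightarrow> 'x oper"
  where "orth_proj X W v = (THE w. w \<in> W \<and> (\<forall>u\<in>W. cinner X u (v - w) = 0))"

text \<open>
  The tensor product of the spaces \<open>hilb (B i)\<close>, \<open>i \<in> J\<close>, is \<open>hilb (PiE J B)\<close>: the basis vector
  \<open>ket b\<close> is the tensor product of the \<open>ket (b i)\<close>. The matrix entries of a tensor product of
  operators are the products of the entries of its factors.
\<close>

definition tensor_op :: "'j set \<Rightarrow> ('j \<Rightarrow> 'i set) \<Rightarrow> ('j \<Rightarrow> 'i oper) \<Rightarrow> ('j \<Rightarrow> 'i) oper"
  where "tensor_op J B A v =
    (\<lambda>a. if a \<in> PiE J B then \<Sum>b\<in>PiE J B. (\<Prod>i\<in>J. A i (ket (b i)) (a i)) * v b else 0)"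

text \<open>The linear extension of a map on basis vectors.\<close>

definition basis_map_op :: "'x set \<Rightarrow> ('x \<Rightarrow> 'x) \<Rightarrow> 'x oper"
  where "basis_map_op X f v = (\<Sum>x\<in>X. v x *\<^sub>C ket (f x))"


section \<open>Unitary representations\<close>

text \<open>
  A pair \<open>(I, R)\<close> stands for the action \<open>R\<close> of a group on \<open>hilb I\<close>. Only the values of \<open>R g\<close> on
  \<open>hilb I\<close> for \<open>g\<close> in the carrier matter.
\<close>

type_synonym ('g, 'i) rep = "'i set \<times> ('g \<Rightarrow> 'i oper)"

definition unitary_rep :: "('g, 'm) monoid_scheme \<Rightarrow> ('g, 'i) rep \<Rightarrow> bool"
  where "unitary_rep G = (\<lambda>(I, R).
    finite I \<and>
    (\<forall>g\<in>carrier G. clin (R g) \<and> R g ` hilb I \<subseteq> hilb I \<and>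
       (\<forall>u\<in>hilb I. \<forall>v\<in>hilb I. cinner I (R g u) (R g v) = cinner I u v)) \<and>
    (\<forall>v\<in>hilb I. R \<one>\<^bsub>G\<^esub> v = v) \<and>
    (\<forall>g\<in>carrier G. \<forall>h\<in>carrier G. \<forall>v\<in>hilb I. R (g \<otimes>\<^bsub>G\<^esub> h) v = R g (R h v)))"

definition invariant_subspace ::
    "('g, 'm) monoid_scheme \<Rightarrow> ('g \<Rightarrow> 'i oper) \<Rightarrow> 'i vect set \<Rightarrow> bool"
  where "invariant_subspace G R U \<longleftrightarrow> cvs.subspace U \<and> (\<forall>g\<in>carrier G. R g ` U \<subseteq> U)"

definition irrep :: "('g, 'm) monoid_scheme \<Rightarrow> ('g, 'i) rep \<Rightarrow> bool"
  where "irrep G = (\<lambda>(I, R).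
    unitary_rep G (I, R) \<and> hilb I \<noteq> {0} \<and>
    (\<forall>U. U \<subseteq> hilb I \<and> invariant_subspace G R U \<longrightarrow> U = {0} \<or> U = hilb I))"

text \<open>The actions \<open>R\<close> on the space \<open>V\<close> and \<open>S\<close> on the space \<open>W\<close> are isomorphic.\<close>

definition equivariant_iso ::
    "('g, 'm) monoid_scheme \<Rightarrow> 'i vect set \<Rightarrow> ('g \<Rightarrow> 'i oper) \<Rightarrow>
     'j vect set \<Rightarrow> ('g \<Rightarrow> 'j oper) \<Rightarrow> bool"
  where "equivariant_iso G V R W S \<longleftrightarrow>
    (\<exists>T. clin T \<and> bij_betw T V W \<and> (\<forall>g\<in>carrier G. \<forall>v\<in>V. T (R g v) = S g (T v)))"

definition rep_iso :: "('g, 'm) monoid_scheme \<Rightarrow> ('g, 'i) rep \<Rightarrow> ('g, 'j) rep \<Rightarrow> bool"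
  where "rep_iso G = (\<lambda>(I, R) (J, S). equivariant_iso G (hilb I) R (hilb J) S)"

text \<open>
  Every finite-dimensional unitary representation is isomorphic to one
  whose orthonormal basis is indexed by a finite set of natural numbers.
\<close>

definition unitary_dual :: "('g, 'm) monoid_scheme \<Rightarrow> ('g, nat) rep set set"
  where "unitary_dual G =
    {\<sigma>. irrep G \<sigma>} // {(\<sigma>, \<tau>). irrep G \<sigma> \<and> irrep G \<tau> \<and> rep_iso G \<sigma> \<tau>}"

definition class_rep :: "('g, 'i) rep set \<Rightarrow> ('g, 'i) rep"
  where "class_rep C = (SOME \<sigma>. \<sigma> \<in> C)"

text \<open>The representation \<open>\<Otimes>\<^sub>i \<sigma>\<^sub>i\<close> of the direct power of the group.\<close>

definition outer_tensor :: "'j set \<Rightarrow> ('j \<Rightarrow> ('g, 'i) rep) \<Rightarrow> ('j \<Rightarrow> 'g, 'j \<Rightarrow> 'i) rep"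
  where "outer_tensor J \<sigma> =
    (PiE J (\<lambda>i. fst (\<sigma> i)),
     \<lambda>g. tensor_op J (\<lambda>i. fst (\<sigma> i)) (\<lambda>i. snd (\<sigma> i) (g i)))"

definition isotypic ::
    "('g, 'm) monoid_scheme \<Rightarrow> 'x vect set \<Rightarrow> ('g \<Rightarrow> 'x oper) \<Rightarrow> ('g, 'i) rep \<Rightarrow> 'x vect set"
  where "isotypic G V R \<eta> = cvs.span (\<Union>{U. U \<subseteq> V \<and> invariant_subspace G R U \<and>
    equivariant_iso G U R (hilb (fst \<eta>)) (snd \<eta>)})"

definition missing_harmonic ::
    "('g, 'm) monoid_scheme \<Rightarrow> 'g set \<Rightarrow> ('g, 'i) rep \<Rightarrow> bool"
  where "missing_harmonic G H \<eta> \<longleftrightarrow> irrep G \<eta> \<and>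
    (\<forall>v\<in>hilb (fst \<eta>). (1 / of_nat (card H)) *\<^sub>C (\<Sum>h\<in>H. snd \<eta> h v) = 0)"


section \<open>Coset states\<close>

definition power_group :: "('g, 'm) monoid_scheme \<Rightarrow> nat \<Rightarrow> (nat \<Rightarrow> 'g) monoid"
  where "power_group G k = product_group {1..k} (\<lambda>_. G)"

definition coset_state :: "('g, 'm) monoid_scheme \<Rightarrow> 'g set \<Rightarrow> 'g \<Rightarrow> 'g vect"
  where "coset_state G K c =
    (1 / complex_of_real (sqrt (real (card K)))) *\<^sub>C (\<Sum>h\<in>K. ket (c \<otimes>\<^bsub>G\<^esub> h))"

definition coset_density :: "('g, 'm) monoid_scheme \<Rightarrow> 'g set \<Rightarrow> 'g oper"
  where "coset_density G K = (\<lambda>v. (1 / of_nat (order G)) *\<^sub>C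
    (\<Sum>c\<in>carrier G. ketbra (carrier G) (coset_state G K c) (coset_state G K c) v))"

definition coset_density_power :: "('g, 'm) monoid_scheme \<Rightarrow> nat \<Rightarrow> 'g set \<Rightarrow> (nat \<Rightarrow> 'g) oper"
  where "coset_density_power G k K =
    tensor_op {1..k} (\<lambda>_. carrier G) (\<lambda>_. coset_density G K)"


section \<open>The measurement\<close>

text \<open>Right multiplication: of the power group, and diagonally on the registers in \<open>I\<close>.\<close>

definition right_mult ::
    "('g, 'm) monoid_scheme \<Rightarrow> nat \<Rightarrow> (nat \<Rightarrow> 'g) \<Rightarrow> (nat \<Rightarrow> 'g) oper"
  where "right_mult G k g = basis_map_op (carrier (power_group G k))
    (\<lambda>x. \<lambda>i\<in>{1..k}. x i \<otimes>\<^bsub>G\<^esub> inv\<^bsub>G\<^esub> (g i))"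

definition diag_right_mult ::
    "('g, 'm) monoid_scheme \<Rightarrow> nat \<Rightarrow> nat set \<Rightarrow> 'g \<Rightarrow> (nat \<Rightarrow> 'g) oper"
  where "diag_right_mult G k I g = basis_map_op (carrier (power_group G k))
    (\<lambda>x. \<lambda>i\<in>{1..k}. if i \<in> I then x i \<otimes>\<^bsub>G\<^esub> inv\<^bsub>G\<^esub> g else x i)"

text \<open>
  The projections of weak Fourier sampling. An isotypic component depends on the representation only
  up to isomorphism, so the choice of representatives is immaterial.
\<close>

definition weak_proj ::
    "('g, 'm) monoid_scheme \<Rightarrow> nat \<Rightarrow> (nat \<Rightarrow> ('g, nat) rep set) \<Rightarrow> (nat \<Rightarrow> 'g) oper"
  where "weak_proj G k \<sigma> = orth_proj (carrier (power_group G k))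
    (isotypic (power_group G k) (hilb (carrier (power_group G k))) (right_mult G k)
      (outer_tensor {1..k} (\<lambda>i. class_rep (\<sigma> i))))"

definition W_reg ::
    "('g, 'm) monoid_scheme \<Rightarrow> nat \<Rightarrow> ('g, 'i) rep \<Rightarrow> (nat \<Rightarrow> ('g, nat) rep set) \<Rightarrow>
     nat set \<Rightarrow> (nat \<Rightarrow> 'g) vect set"
  where "W_reg G k \<eta> \<sigma> I =
    isotypic G (hilb (carrier (power_group G k))) (diag_right_mult G k I) \<eta> \<inter>
    weak_proj G k \<sigma> ` hilb (carrier (power_group G k))"

definition W_span ::
    "('g, 'm) monoid_scheme \<Rightarrow> nat \<Rightarrow> ('g, 'i) rep \<Rightarrow> (nat \<Rightarrow> ('g, nat) rep set) \<Rightarrow>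
     (nat \<Rightarrow> 'g) vect set"
  where "W_span G k \<eta> \<sigma> = cvs.span (\<Union>I\<in>{I. I \<subseteq> {1..k} \<and> I \<noteq> {}}. W_reg G k \<eta> \<sigma> I)"

definition Proj_W ::
    "('g, 'm) monoid_scheme \<Rightarrow> nat \<Rightarrow> ('g, 'i) rep \<Rightarrow> (nat \<Rightarrow> ('g, nat) rep set) \<Rightarrow>
     (nat \<Rightarrow> 'g) oper"
  where "Proj_W G k \<eta> \<sigma> = orth_proj (carrier (power_group G k)) (W_span G k \<eta> \<sigma>)"

text \<open>
  The probability that the measurement applied to the density matrix \<open>\<rho>\<close> reports ``trivial''.
  Since \<open>W_span G k \<eta> \<sigma>\<close> lies in the image of \<open>weak_proj G k \<sigma>\<close>, sampling \<open>\<sigma>\<close> first does not change the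
  probability of observing the state in \<open>W_span G k \<eta> \<sigma>\<close>. Kept complex-valued: \<open>a \<ge> b\<close>
  in \<open>Complex_Order\<close> says that \<open>Re a \<ge> Re b\<close> and \<open>Im a = Im b\<close>.
\<close>

definition prob_trivial ::
    "('g, 'm) monoid_scheme \<Rightarrow> nat \<Rightarrow> ('g, 'i) rep \<Rightarrow> (nat \<Rightarrow> 'g) oper \<Rightarrow> complex"
  where "prob_trivial G k \<eta> \<rho> =
    (\<Sum>\<sigma>\<in>({1..k} \<rightarrow>\<^sub>E unitary_dual G). op_trace (carrier (power_group G k)) (Proj_W G k \<eta> \<sigma> \<circ> \<rho>))"

end

theory Submission
  imports Defs "HOL-Algebra.Group_Action" "HOL-Analysis.Convex"
begin

text \<open>
  Part (a): summing the diagonal action over \<open>H'\<close> annihilates the \<open>\<eta>\<close>-isotypic component, because \<open>\<eta>\<close> is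
  missing, but fixes every vector in the image of the coset density. As the action is unitary, the
  two subspaces are orthogonal.

  Part (b): the probability is \<open>d / |G|\<^sup>k\<close>, where \<open>d\<close> is the sum of the dimensions of the
  spaces \<open>W\<^sub>\<eta>\<^sub>,\<^sub>\<sigma>\<close>. Fix a diagonal coefficient \<open>c(g) = \<langle>a, \<eta>(g) a\<rangle>\<close> and let
  \<open>A\<^sub>I |x\<rangle> = \<Sum>\<^sub>g c(g) |x \<cdot>\<^sub>I g\<rangle>\<close>, with \<open>\<cdot>\<^sub>I\<close> right multiplication on the registers in \<open>I\<close>. The
  image of \<open>A\<^sub>I\<close> is \<open>\<eta>\<close>-isotypic, \<open>tr A\<^sub>I = |G|\<^sup>k\<close>, and in the Hilbert-Schmidt inner product
  \<open>\<langle>A\<^sub>I, A\<^sub>J\<rangle> = |G|\<^sup>k\<close> for \<open>I \<noteq> J\<close>, since then \<open>x \<cdot>\<^sub>I g = x \<cdot>\<^sub>J h\<close> only for \<open>g = h = 1\<close>, while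
  \<open>\<langle>A\<^sub>I, A\<^sub>I\<rangle> \<le> |G|\<^sup>k |G|\<close>. For \<open>A = \<Sum>\<^sub>I A\<^sub>I\<close>, a sum of \<open>M = 2\<^sup>k - 1 \<ge> |G| - 1\<close> operators, the
  Cauchy-Schwarz inequality \<open>|tr A|\<^sup>2 \<le> (rank A) \<langle>A, A\<rangle>\<close> yields
  \<open>rank A \<ge> |G|\<^sup>k M / (|G| + M - 1) \<ge> |G|\<^sup>k / 2\<close>.
  By the Peter-Weyl theorem for each register, the image of \<open>A\<close> lies in the sum of the \<open>W\<^sub>\<eta>\<^sub>,\<^sub>\<sigma>\<close>, so
  \<open>d \<ge> rank A\<close>.
\<close>

section \<open>Orthonormal bases and orthogonal projections\<close>

lemma sum_fun_apply: "(\<Sum>i\<in>A. f i) x = (\<Sum>i\<in>A. f i x)"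
  by (induction A rule: infinite_finite_induct) auto

lemma cscale_apply: "(c *\<^sub>C v) x = c * v x"
  by (simp add: cscale_def)

text \<open>
  As default simplification rules, the pointwise equations turn a sum of two vectors into a
  \<open>\<lambda>\<close>-term, to which the equations for linear maps no longer apply.
\<close>

declare plus_fun_apply [simp del] zero_fun_apply [simp del] minus_apply [simp del]

lemmas vect_apply = plus_fun_apply zero_fun_apply minus_apply cscale_apply sum_fun_apply

lemma clinI:
  assumes "\<And>u v. f (u + v) = f u + f v" and "\<And>c v. f (c *\<^sub>C v) = c *\<^sub>C f v"
  shows "clin f"
  by unfold_locales (auto simp: assms)

lemma clin_add: "clin f \<Longrightarrow> f (u + v) = f u + f v"
  and clin_scale: "clin f \<Longrightarrow> f (c *\<^sub>C v) = c *\<^sub>C f v"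
  by (simp_all add: Vector_Spaces.linear_def module_hom_def module_hom_axioms_def)

lemma clin_0: "clin f \<Longrightarrow> f 0 = 0"
  using clin_add[of f 0 0] by simp

lemma clin_diff: "clin f \<Longrightarrow> f (u - v) = f u - f v"
  using clin_add[of f "u - v" v] by (simp add: algebra_simps)

lemma clin_sum: "clin f \<Longrightarrow> f (\<Sum>i\<in>A. g i) = (\<Sum>i\<in>A. f (g i))"
  by (induction A rule: infinite_finite_induct) (auto simp: clin_0 clin_add)

lemma clin_comp: "clin f \<Longrightarrow> clin g \<Longrightarrow> clin (\<lambda>v. f (g v))"
  by (auto intro!: clinI simp: clin_add clin_scale)

lemma subspace_image: "clin f \<Longrightarrow> cvs.subspace U \<Longrightarrow> cvs.subspace (f ` U)"
  unfolding cvs.subspace_def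
  by (auto simp: image_iff) (metis clin_0, metis clin_add, metis clin_scale)

lemma span_image_subset:
  assumes "clin f" and "f ` S \<subseteq> T" and "cvs.subspace T"
  shows "f ` cvs.span S \<subseteq> T"
proof -
  have "cvs.subspace {v. f v \<in> T}"
    using assms unfolding cvs.subspace_def by (auto simp: clin_0 clin_add clin_scale)
  then show ?thesis
    using cvs.span_minimal[of S "{v. f v \<in> T}"] assms(2) by auto
qed

lemma subspace_hilb: "cvs.subspace (hilb X)"
  by (auto simp: cvs.subspace_def hilb_def vect_apply)

lemma ket_in_hilb: "x \<in> X \<Longrightarrow> ket x \<in> hilb X"
  by (auto simp: hilb_def ket_def)

lemma sum_ket_apply: "finite X \<Longrightarrow> (\<Sum>x\<in>X. c x * ket x y) = (if y \<in> X then c y else 0)"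
  by (simp add: ket_def if_distrib cong: if_cong)

lemma hilb_expand:
  assumes "finite X" and "v \<in> hilb X"
  shows "v = (\<Sum>x\<in>X. v x *\<^sub>C ket x)"
  using assms by (auto simp: fun_eq_iff vect_apply sum_ket_apply hilb_def)

lemma clin_apply_expand:
  assumes "finite X" and "clin f" and "v \<in> hilb X"
  shows "f v a = (\<Sum>x\<in>X. v x * f (ket x) a)"
proof -
  have "f (\<Sum>x\<in>X. v x *\<^sub>C ket x) a = (\<Sum>x\<in>X. v x * f (ket x) a)"
    by (simp add: clin_sum clin_scale assms vect_apply)
  then show ?thesis
    using hilb_expand[OF assms(1,3)] by simp
qed

lemma clin_sumI: "(\<And>i. i \<in> A \<Longrightarrow> clin (f i)) \<Longrightarrow> clin (\<lambda>v. \<Sum>i\<in>A. f i v)"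
  by (auto intro!: clinI simp: clin_add clin_scale sum.distrib cvs.scale_sum_right)

lemma clin_coord: "clin f \<Longrightarrow> clin (\<lambda>u. f u a *\<^sub>C w)"
  by (auto intro!: clinI simp: clin_add clin_scale fun_eq_iff vect_apply algebra_simps)

text \<open>An inverse is determined only on the image of \<open>V\<close>, but \<open>clin\<close>
  asks for linearity on the whole function type. A linear extension is therefore chosen once here
  and reused wherever an intertwiner or an injective map has to be inverted.\<close>

lemma clin_left_inverse:
  assumes "clin f" and "cvs.subspace V" and "inj_on f V"
  obtains g where "clin g" and "\<And>v. v \<in> V \<Longrightarrow> g (f v) = v"
proof -
  interpret vector_space_pair "cscale :: complex \<Rightarrow> 'a vect \<Rightarrow> _"
    "cscale :: complex \<Rightarrow> 'b vect \<Rightarrow> _" ..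
  show ?thesis
    using linear_exists_left_inverse_on[OF assms] that by auto
qed

section \<open>The inner product\<close>

lemma cinner_add_right: "cinner X u (v + w) = cinner X u v + cinner X u w"
  and cinner_add_left: "cinner X (u + v) w = cinner X u w + cinner X v w"
  and cinner_scale_right: "cinner X u (c *\<^sub>C v) = c * cinner X u v"
  and cinner_scale_left: "cinner X (c *\<^sub>C u) v = cnj c * cinner X u v"
  and cinner_diff_right: "cinner X u (v - w) = cinner X u v - cinner X u w"
  and cinner_diff_left: "cinner X (u - v) w = cinner X u w - cinner X v w"
  and cinner_zero_right: "cinner X u 0 = 0"
  and cinner_zero_left: "cinner X 0 u = 0"
  by (simp_all add: cinner_def vect_apply algebra_simps sum.distrib sum_distrib_left sum_subtractf)

lemma cinner_sum_right: "cinner X u (\<Sum>i\<in>A. f i) = (\<Sum>i\<in>A. cinner X u (f i))"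
  by (induction A rule: infinite_finite_induct) (auto simp: cinner_zero_right cinner_add_right)

lemma cinner_sum_left: "cinner X (\<Sum>i\<in>A. f i) u = (\<Sum>i\<in>A. cinner X (f i) u)"
  by (induction A rule: infinite_finite_induct) (auto simp: cinner_zero_left cinner_add_left)

lemma cnj_cinner: "cnj (cinner X u v) = cinner X v u"
  by (simp add: cinner_def mult.commute)

lemma cinner_ket: "finite X \<Longrightarrow> x \<in> X \<Longrightarrow> cinner X (ket x) v = v x"
  by (simp add: cinner_def ket_def if_distrib[of cnj] if_distrib[of "\<lambda>c. c * _"] cong: if_cong)

lemma cnj_mult_self: "cnj z * z = of_real ((cmod z)\<^sup>2)"
  by (subst complex_norm_square) (rule mult.commute)

lemma cinner_self: "cinner X v v = of_real (\<Sum>x\<in>X. (cmod (v x))\<^sup>2)"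
  unfolding cinner_def cnj_mult_self by simp

lemma cinner_self_eq_0: "finite X \<Longrightarrow> v \<in> hilb X \<Longrightarrow> cinner X v v = 0 \<longleftrightarrow> v = 0"
  unfolding cinner_self of_real_eq_0_iff
  by (subst sum_nonneg_eq_0_iff) (auto simp: hilb_def fun_eq_iff vect_apply)

lemma orth_span:
  assumes "\<And>u. u \<in> S \<Longrightarrow> cinner X u v = 0" and "u \<in> cvs.span S"
  shows "cinner X u v = 0"
proof -
  have "cvs.subspace {u. cinner X u v = 0}"
    by (auto simp: cvs.subspace_def cinner_zero_left cinner_add_left cinner_scale_left)
  then show ?thesis
    using cvs.span_minimal[of S "{u. cinner X u v = 0}"] assms by auto
qed

text \<open>Two candidates differ by a vector of \<open>W\<close> that is orthogonal to itself,
  hence zero. This justifies the definite description in \<open>orth_proj\<close>; all later values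
  of projections are computed through it.\<close>

lemma orth_proj_unique:
  assumes "finite X" and "cvs.subspace W" and "W \<subseteq> hilb X"
    and "w \<in> W" and "\<And>u. u \<in> W \<Longrightarrow> cinner X u (v - w) = 0"
  shows "orth_proj X W v = w"
  unfolding orth_proj_def
proof (rule the_equality)
  fix w' assume w': "w' \<in> W \<and> (\<forall>u\<in>W. cinner X u (v - w') = 0)"
  have d: "w - w' \<in> W"
    using w' assms cvs.subspace_diff by blast
  have "cinner X (w - w') ((v - w') - (v - w)) = 0"
    using w' d assms(5) unfolding cinner_diff_right[of X _ "v - w'"] by simp
  then have "w - w' = 0"
    using cinner_self_eq_0[OF assms(1), of "w - w'"] d assms(3) by (auto simp: algebra_simps)
  then show "w' = w" by simp
qed (use assms in auto)

section \<open>Orthonormal sets, Bessel's inequality and orthonormal bases\<close>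

definition orthonormal :: "'x set \<Rightarrow> 'x vect set \<Rightarrow> bool"
  where "orthonormal X E \<longleftrightarrow> finite E \<and> (\<forall>u\<in>E. \<forall>v\<in>E. cinner X u v = (if u = v then 1 else 0))"

text \<open>For orthonormal \<open>E\<close> this is the orthogonal projection onto the span of
  \<open>E\<close>, in a form that can be computed with.\<close>

definition expansion :: "'x set \<Rightarrow> 'x vect set \<Rightarrow> 'x oper"
  where "expansion X E v = (\<Sum>e\<in>E. cinner X e v *\<^sub>C e)"

lemma cinner_expansion:
  assumes "orthonormal X E" and "e \<in> E"
  shows "cinner X e (expansion X E v) = cinner X e v"
proof -
  have "cinner X e (expansion X E v) = (\<Sum>e'\<in>E. cinner X e' v * (if e = e' then 1 else 0))"
    using assms by (auto simp: expansion_def cinner_sum_right cinner_scale_right orthonormal_def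
        intro!: sum.cong)
  also have "\<dots> = cinner X e v"
    using assms by (simp add: orthonormal_def if_distrib cong: if_cong)
  finally show ?thesis .
qed

lemma expansion_in_span: "expansion X E v \<in> cvs.span E"
  unfolding expansion_def by (intro cvs.span_sum cvs.span_scale cvs.span_base)

lemma orth_proj_onb:
  assumes "finite X" and "orthonormal X E" and "cvs.span E = W" and "W \<subseteq> hilb X"
  shows "orth_proj X W v = expansion X E v"
proof (rule orth_proj_unique)
  show "cinner X u (v - expansion X E v) = 0" if "u \<in> W" for u
    using orth_span[of E X "v - expansion X E v" u] that assms
    by (auto simp: cinner_diff_right cinner_expansion)
qed (use assms expansion_in_span in auto)

lemma orth_proj_in_subspace:
  assumes "finite X" and "cvs.subspace W" and "W \<subseteq> hilb X" and "w \<in> W"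
  shows "orth_proj X W w = w"
  using assms by (intro orth_proj_unique) (auto simp: cinner_zero_right)

lemma expansion_id:
  assumes "finite X" and "orthonormal X E" and "E \<subseteq> hilb X" and "v \<in> cvs.span E"
  shows "expansion X E v = v"
proof -
  have "cvs.span E \<subseteq> hilb X"
    by (rule cvs.span_minimal[OF assms(3) subspace_hilb])
  then show ?thesis
    using orth_proj_onb[OF assms(1,2) refl, of v] orth_proj_in_subspace[OF assms(1) _ _ assms(4)]
    by auto
qed

text \<open>The squared norm of \<open>v - expansion X E v\<close> is nonnegative and equals the
  right-hand side minus the left-hand side.\<close>

lemma bessel:
  assumes "orthonormal X E"
  shows "(\<Sum>e\<in>E. (cmod (cinner X e v))\<^sup>2) \<le> (\<Sum>x\<in>X. (cmod (v x))\<^sup>2)"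
proof -
  let ?s = "\<Sum>e\<in>E. (cmod (cinner X e v))\<^sup>2" and ?p = "expansion X E v"
  have 1: "cinner X ?p w = (\<Sum>e\<in>E. cnj (cinner X e v) * cinner X e w)" for w
    by (simp add: expansion_def cinner_sum_left cinner_scale_left)
  have 2: "cinner X ?p ?p = of_real ?s" and 3: "cinner X ?p v = of_real ?s"
    unfolding 1 of_real_sum cnj_mult_self[symmetric]
    by (auto intro!: sum.cong simp: cinner_expansion assms)
  have 4: "cinner X v ?p = of_real ?s"
    unfolding cnj_cinner[of X ?p v, symmetric] 3 by simp
  have "complex_of_real (\<Sum>x\<in>X. (cmod ((v - ?p) x))\<^sup>2)
      = cinner X v v - cinner X v ?p - (cinner X ?p v - cinner X ?p ?p)"
    unfolding cinner_self[symmetric] cinner_diff_left cinner_diff_right by algebra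
  also have "\<dots> = complex_of_real ((\<Sum>x\<in>X. (cmod (v x))\<^sup>2) - ?s)"
    unfolding 2 3 4 unfolding cinner_self by simp
  finally have "(\<Sum>x\<in>X. (cmod ((v - ?p) x))\<^sup>2) = (\<Sum>x\<in>X. (cmod (v x))\<^sup>2) - ?s"
    unfolding of_real_eq_iff .
  moreover have "0 \<le> (\<Sum>x\<in>X. (cmod ((v - ?p) x))\<^sup>2)"
    by (intro sum_nonneg) simp
  ultimately show ?thesis by linarith
qed

text \<open>The sum of \<open>(cmod (e x))\<^sup>2\<close> over all \<open>e\<close> and
  \<open>x\<close> is counted in two ways: each \<open>e\<close> contributes 1, and each
  \<open>x\<close> contributes at most 1 by Bessel's inequality for \<open>ket x\<close>. The bound
  makes an orthonormal set of maximal size available.\<close>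

lemma orthonormal_card_le:
  assumes "finite X" and "orthonormal X E"
  shows "card E \<le> card X"
proof -
  have "real (card E) = (\<Sum>e\<in>E. (\<Sum>x\<in>X. (cmod (e x))\<^sup>2))"
  proof -
    have "(\<Sum>x\<in>X. (cmod (e x))\<^sup>2) = 1" if "e \<in> E" for e
      using that assms(2) cinner_self[of X e] unfolding orthonormal_def
      by (metis of_real_eq_1_iff)
    then show ?thesis by simp
  qed
  also have "\<dots> = (\<Sum>x\<in>X. \<Sum>e\<in>E. (cmod (e x))\<^sup>2)"
    by (rule sum.swap)
  also have "\<dots> \<le> (\<Sum>x\<in>X. 1)"
  proof (rule sum_mono)
    fix x assume x: "x \<in> X"
    have "cmod (e x) = cmod (cinner X e (ket x))" for e
      using cinner_ket[OF assms(1) x, of e] cnj_cinner[of X "ket x" e] by (metis complex_mod_cnj)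
    then have "(\<Sum>e\<in>E. (cmod (e x))\<^sup>2) \<le> (\<Sum>y\<in>X. (cmod (ket x y))\<^sup>2)"
      using bessel[OF assms(2), of "ket x"] by simp
    also have "\<dots> = (\<Sum>y\<in>X. if y = x then 1 else 0)"
      by (rule sum.cong) (auto simp: ket_def)
    also have "\<dots> = 1"
      using x assms(1) by simp
    finally show "(\<Sum>e\<in>E. (cmod (e x))\<^sup>2) \<le> 1" .
  qed
  finally show ?thesis by simp
qed

text \<open>One Gram-Schmidt step: the residue of \<open>w\<close> after projection is nonzero and
  is normalised.\<close>

lemma orthonormal_extend:
  assumes "finite X" and "cvs.subspace W" and "W \<subseteq> hilb X"
    and "orthonormal X E" and "E \<subseteq> W" and "w \<in> W" and "w \<notin> cvs.span E"
  obtains e where "e \<in> W" and "e \<notin> E" and "orthonormal X (insert e E)"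
proof -
  define r where "r = w - expansion X E w"
  have spE: "cvs.span E \<subseteq> W"
    by (rule cvs.span_minimal[OF assms(5,2)])
  have rW: "r \<in> W"
    using assms(2,6) expansion_in_span[of X E w] spE unfolding r_def
    by (auto intro: cvs.subspace_diff)
  have r0: "r \<noteq> 0"
    using assms(7) expansion_in_span[of X E w] by (auto simp: r_def)
  have orth: "cinner X u r = 0" if "u \<in> cvs.span E" for u
    by (rule orth_span[OF _ that]) (simp add: r_def cinner_diff_right cinner_expansion assms(4))
  define s where "s = (\<Sum>x\<in>X. (cmod (r x))\<^sup>2)"
  have rr: "cinner X r r = of_real s"
    by (simp add: s_def cinner_self)
  have "s \<noteq> 0"
    using cinner_self_eq_0[OF assms(1), of r] r0 rW assms(3) rr by auto
  moreover have "s \<ge> 0"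
    by (simp add: s_def sum_nonneg)
  ultimately have s: "s > 0" by simp
  define e where "e = complex_of_real (1 / sqrt s) *\<^sub>C r"
  have ee: "cinner X e e = 1"
  proof -
    have "cinner X e e = of_real ((1 / sqrt s) * (1 / sqrt s) * s)"
      by (simp only: e_def cinner_scale_left cinner_scale_right rr complex_cnj_complex_of_real
          of_real_mult mult.assoc)
    also have "(1 / sqrt s) * (1 / sqrt s) * s = 1"
      using s by (simp add: field_simps)
    finally show ?thesis by simp
  qed
  have e0: "cinner X u e = 0" if "u \<in> cvs.span E" for u
    using orth[OF that] by (simp add: e_def cinner_scale_right)
  have e0': "cinner X e u = 0" if "u \<in> cvs.span E" for u
    using e0[OF that] cnj_cinner[of X u e] by simp
  show ?thesis
  proof
    show "e \<in> W"
      unfolding e_def by (rule cvs.subspace_scale[OF assms(2) rW])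
    show "e \<notin> E"
      using ee e0 cvs.span_base by fastforce
    then show "orthonormal X (insert e E)"
      using assms(4) ee e0 e0' cvs.span_base unfolding orthonormal_def by auto
  qed
qed

text \<open>An orthonormal subset of \<open>W\<close> of maximal cardinality spans \<open>W\<close>,
  since otherwise it could be extended.\<close>

lemma onb_exists:
  assumes "finite X" and "cvs.subspace W" and "W \<subseteq> hilb X"
  obtains E where "orthonormal X E" and "cvs.span E = W" and "E \<subseteq> W"
proof -
  let ?P = "\<lambda>E. orthonormal X E \<and> E \<subseteq> W"
  have "?P {}" by (simp add: orthonormal_def)
  moreover have "\<forall>E. ?P E \<longrightarrow> card E < Suc (card X)"
    using orthonormal_card_le[OF assms(1)] by (simp add: less_Suc_eq_le)
  ultimately obtain E where E: "?P E" and max: "\<And>E'. ?P E' \<Longrightarrow> card E' \<le> card E"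
    using Lattices_Big.ex_has_greatest_nat[of ?P "{}" card "Suc (card X)"] by (metis less_imp_le)
  have "W \<subseteq> cvs.span E"
  proof
    fix w assume w: "w \<in> W"
    show "w \<in> cvs.span E"
    proof (rule ccontr)
      assume "w \<notin> cvs.span E"
      then obtain e where "e \<in> W" "e \<notin> E" "orthonormal X (insert e E)"
        using orthonormal_extend[OF assms] E w by metis
      then show False
        using max[of "insert e E"] E by (auto simp: orthonormal_def)
    qed
  qed
  moreover have "cvs.span E \<subseteq> W"
    using E assms by (intro cvs.span_minimal) auto
  ultimately show ?thesis
    using that E by auto
qed

section \<open>Dimensions of subspaces\<close>

lemma orthonormal_independent:
  assumes "orthonormal X E"
  shows "\<not> cvs.dependent E"
  unfolding cvs.dependent_def
proof safe
  fix e assume e: "e \<in> E" "e \<in> cvs.span (E - {e})"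
  have "cinner X e e = 0"
    using assms e(1) by (intro orth_span[OF _ e(2)]) (auto simp: orthonormal_def)
  then show False
    using assms e(1) by (auto simp: orthonormal_def)
qed

lemma dim_onb:
  assumes "orthonormal X E"
  shows "cvs.dim (cvs.span E) = card E"
  using cvs.dim_eq_card_independent[OF orthonormal_independent[OF assms]] by simp

text \<open>An orthonormal basis of \<open>U\<close> extends by one vector inside \<open>V\<close>.
  The function type itself may have infinite dimension, so finiteness enters through
  \<open>X\<close>. The lemma drives the induction on dimension in
  \<open>invariant_subspace_coeff_span\<close>.\<close>

lemma dim_strict_mono:
  assumes "finite X" and "cvs.subspace U" and "cvs.subspace V" and "U \<subset> V" and "V \<subseteq> hilb X"
  shows "cvs.dim U < cvs.dim V"
proof -
  have UX: "U \<subseteq> hilb X" using assms by auto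
  obtain E where E: "orthonormal X E" "cvs.span E = U" "E \<subseteq> U"
    using onb_exists[OF assms(1,2) UX] .
  have EV: "E \<subseteq> V" using E(3) assms(4) by auto
  obtain w where w: "w \<in> V" "w \<notin> cvs.span E"
    using E assms(4) by auto
  obtain e where e: "e \<in> V" "e \<notin> E" "orthonormal X (insert e E)"
    using orthonormal_extend[OF assms(1,3,5) E(1) EV w] .
  obtain F where F: "orthonormal X F" "cvs.span F = V" "F \<subseteq> V"
    using onb_exists[OF assms(1,3,5)] .
  have finF: "finite F" and finE: "finite E"
    using F(1) E(1) by (auto simp: orthonormal_def)
  have "insert e E \<subseteq> cvs.span F"
    using e(1) EV F(2) by auto
  then have "card (insert e E) \<le> card F"
    using cvs.independent_span_bound[OF finF orthonormal_independent[OF e(3)]] by blast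
  then have "card E < card F"
    using e(2) finE by simp
  then show ?thesis
    using dim_onb[OF E(1)] dim_onb[OF F(1)] E(2) F(2) by simp
qed

section \<open>Representations and the unitary dual\<close>

text \<open>The linear content of \<open>unitary_rep\<close>, on an arbitrary subspace rather than a
  full coordinate space, so that it also covers invariant subspaces.\<close>

definition action ::
    "('g, 'm) monoid_scheme \<Rightarrow> 'x vect set \<Rightarrow> ('g \<Rightarrow> 'x oper) \<Rightarrow> bool"
  where "action G V R \<longleftrightarrow> cvs.subspace V \<and>
    (\<forall>g\<in>carrier G. clin (R g) \<and> R g ` V \<subseteq> V) \<and>
    (\<forall>v\<in>V. R \<one>\<^bsub>G\<^esub> v = v) \<and>
    (\<forall>g\<in>carrier G. \<forall>h\<in>carrier G. \<forall>v\<in>V. R (g \<otimes>\<^bsub>G\<^esub> h) v = R g (R h v))"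

lemma actionD:
  assumes "action G V R"
  shows "cvs.subspace V" and "g \<in> carrier G \<Longrightarrow> clin (R g)"
    and "g \<in> carrier G \<Longrightarrow> v \<in> V \<Longrightarrow> R g v \<in> V"
    and "v \<in> V \<Longrightarrow> R \<one>\<^bsub>G\<^esub> v = v"
    and "g \<in> carrier G \<Longrightarrow> h \<in> carrier G \<Longrightarrow> v \<in> V \<Longrightarrow> R (g \<otimes>\<^bsub>G\<^esub> h) v = R g (R h v)"
  using assms unfolding action_def by blast+

lemma unitary_rep_action: "unitary_rep G (B, \<sigma>) \<Longrightarrow> action G (hilb B) \<sigma>"
  unfolding unitary_rep_def action_def using subspace_hilb by blast

lemma irrep_action: "irrep G (B, \<sigma>) \<Longrightarrow> action G (hilb B) \<sigma>"
  unfolding irrep_def by (auto intro: unitary_rep_action)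

lemma irrep_finite: "irrep G (B, \<sigma>) \<Longrightarrow> finite B"
  by (simp add: irrep_def unitary_rep_def)

lemma irrep_unitary:
  "irrep G (B, \<sigma>) \<Longrightarrow> g \<in> carrier G \<Longrightarrow> u \<in> hilb B \<Longrightarrow> v \<in> hilb B \<Longrightarrow>
    cinner B (\<sigma> g u) (\<sigma> g v) = cinner B u v"
  by (simp add: irrep_def unitary_rep_def)

lemma irrep_nonempty:
  assumes "irrep G (B, \<sigma>)"
  shows "B \<noteq> {}"
proof
  assume "B = {}"
  then have "hilb B = {0}"
    by (auto simp: hilb_def zero_fun_def)
  then show False
    using assms by (simp add: irrep_def)
qed

lemma equivariant_iso_refl: "equivariant_iso G V R V R"
  unfolding equivariant_iso_def
  by (rule exI[of _ "\<lambda>v. v"]) (auto intro!: clinI simp: bij_betw_def)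

text \<open>The inverse of the intertwiner is replaced by a globally linear left inverse, which
  agrees with it on \<open>W\<close>.\<close>

lemma equivariant_iso_sym:
  assumes "equivariant_iso G V R W S" and "cvs.subspace V"
    and "\<And>g v. g \<in> carrier G \<Longrightarrow> v \<in> V \<Longrightarrow> R g v \<in> V"
  shows "equivariant_iso G W S V R"
proof -
  obtain T where T: "clin T" "bij_betw T V W"
    "\<And>g v. g \<in> carrier G \<Longrightarrow> v \<in> V \<Longrightarrow> T (R g v) = S g (T v)"
    using assms(1) by (auto simp: equivariant_iso_def)
  obtain L where L: "clin L" "\<And>v. v \<in> V \<Longrightarrow> L (T v) = v"
    using clin_left_inverse[OF T(1) assms(2)] T(2) unfolding bij_betw_def by blast
  have W: "W = T ` V"
    using T(2) by (simp add: bij_betw_def)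
  have "bij_betw L W V"
    unfolding W bij_betw_def inj_on_def image_image by (auto simp: L(2))
  moreover have "L (S g w) = R g (L w)" if "g \<in> carrier G" "w \<in> W" for g w
    using that unfolding W by (auto simp: L(2) T(3)[symmetric] assms(3))
  ultimately show ?thesis
    using L(1) unfolding equivariant_iso_def by blast
qed

lemma equivariant_iso_trans:
  assumes "equivariant_iso G V R W S" and "equivariant_iso G W S Z Q"
  shows "equivariant_iso G V R Z Q"
proof -
  obtain T where T: "clin T" "bij_betw T V W"
    "\<And>g v. g \<in> carrier G \<Longrightarrow> v \<in> V \<Longrightarrow> T (R g v) = S g (T v)"
    using assms(1) by (auto simp: equivariant_iso_def)
  obtain T' where T': "clin T'" "bij_betw T' W Z"
    "\<And>g v. g \<in> carrier G \<Longrightarrow> v \<in> W \<Longrightarrow> T' (S g v) = Q g (T' v)"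
    using assms(2) by (auto simp: equivariant_iso_def)
  have "bij_betw (\<lambda>v. T' (T v)) V Z"
    using bij_betw_trans[OF T(2) T'(2)] by (simp add: o_def)
  moreover have "T' (T (R g v)) = Q g (T' (T v))" if "g \<in> carrier G" "v \<in> V" for g v
    using that bij_betwE[OF T(2)] by (simp add: T(3) T'(3))
  ultimately show ?thesis
    using clin_comp[OF T'(1) T(1)] unfolding equivariant_iso_def by blast
qed

lemma irrep_iso_sym:
  assumes "irrep G \<sigma>" and "rep_iso G \<sigma> \<tau>"
  shows "rep_iso G \<tau> \<sigma>"
proof (cases \<sigma>; cases \<tau>)
  fix B s C t assume e: "\<sigma> = (B, s)" "\<tau> = (C, t)"
  note act = irrep_action[OF assms(1)[unfolded e]]
  show ?thesis
    using equivariant_iso_sym[of G "hilb B" s "hilb C" t] assms(2) actionD(1,3)[OF act]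
    unfolding rep_iso_def e by auto
qed

lemma rep_iso_trans: "rep_iso G \<sigma> \<tau> \<Longrightarrow> rep_iso G \<tau> \<rho> \<Longrightarrow> rep_iso G \<sigma> \<rho>"
  unfolding rep_iso_def by (auto split: prod.splits intro: equivariant_iso_trans)

lemma rep_iso_refl: "rep_iso G \<sigma> \<sigma>"
  unfolding rep_iso_def by (auto split: prod.splits intro: equivariant_iso_refl)

section \<open>Classes of irreducible representations and their representatives\<close>

lemma unitary_dual_equiv:
  "equiv {\<sigma>. irrep G \<sigma>} {(\<sigma>, \<tau>). irrep G \<sigma> \<and> irrep G \<tau> \<and> rep_iso G \<sigma> \<tau>}"
  by (rule equivI) (auto simp: refl_on_def sym_def trans_def rep_iso_refl intro: irrep_iso_sym rep_iso_trans)

lemma class_rep_mem: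
  assumes "C \<in> unitary_dual G"
  shows "class_rep C \<in> C"
proof -
  have "C \<noteq> {}"
    using assms in_quotient_imp_non_empty[OF unitary_dual_equiv] unfolding unitary_dual_def by auto
  then show ?thesis
    unfolding class_rep_def by (auto intro: someI)
qed

lemma class_rep_irrep:
  assumes "C \<in> unitary_dual G"
  shows "irrep G (class_rep C)"
  using class_rep_mem[OF assms] assms in_quotient_imp_subset[OF unitary_dual_equiv]
  unfolding unitary_dual_def by blast

lemma unitary_dual_class:
  fixes \<sigma> :: "('g, nat) rep"
  assumes "irrep G \<sigma>"
  obtains C where "C \<in> unitary_dual G" and "rep_iso G (class_rep C) \<sigma>"
proof
  let ?r = "{(\<sigma>, \<tau>). irrep G \<sigma> \<and> irrep G \<tau> \<and> rep_iso G \<sigma> (\<tau> :: ('g, nat) rep)}"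
  show 1: "?r `` {\<sigma>} \<in> unitary_dual G"
    unfolding unitary_dual_def by (rule quotientI) (simp add: assms)
  show "rep_iso G (class_rep (?r `` {\<sigma>})) \<sigma>"
    using class_rep_mem[OF 1] by (auto intro: irrep_iso_sym)
qed

lemma unitary_dual_eqI:
  assumes "C \<in> unitary_dual G" and "D \<in> unitary_dual G"
    and "rep_iso G (class_rep C) (class_rep D)"
  shows "C = D"
  using quotient_eqI[OF unitary_dual_equiv, of C G D "class_rep C" "class_rep D"] assms
    class_rep_mem class_rep_irrep unfolding unitary_dual_def by blast

section \<open>Schur's lemma and isotypic components\<close>

text \<open>The kernel is an invariant subspace of an irreducible representation and is not
  everything, so it is zero.\<close>

lemma schur_injective:
  assumes "irrep G (B, \<sigma>)" and "action G V R" and "clin \<Phi>"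
    and "\<And>g u. g \<in> carrier G \<Longrightarrow> u \<in> hilb B \<Longrightarrow> \<Phi> (\<sigma> g u) = R g (\<Phi> u)"
    and "u \<in> hilb B" and "\<Phi> u \<noteq> 0"
  shows "inj_on \<Phi> (hilb B)"
proof -
  let ?K = "{u \<in> hilb B. \<Phi> u = 0}"
  have "invariant_subspace G \<sigma> ?K"
    unfolding invariant_subspace_def
  proof (intro conjI ballI)
    show "cvs.subspace ?K"
      using subspace_hilb[of B] assms(3)
      by (auto simp: cvs.subspace_def clin_0 clin_add clin_scale)
    show "\<sigma> g ` ?K \<subseteq> ?K" if "g \<in> carrier G" for g
      using that assms(4) actionD(3)[OF irrep_action[OF assms(1)]] actionD(2)[OF assms(2)]
      by (auto simp: clin_0)
  qed
  moreover have "?K \<subseteq> hilb B" "?K \<noteq> hilb B"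
    using assms(5,6) by auto
  ultimately have K: "?K = {0}"
    using assms(1) unfolding irrep_def by blast
  show ?thesis
  proof (rule inj_onI)
    fix v w assume vw: "v \<in> hilb B" "w \<in> hilb B" "\<Phi> v = \<Phi> w"
    then have "v - w \<in> ?K"
      using cvs.subspace_diff[OF subspace_hilb] by (simp add: clin_diff[OF assms(3)])
    then show "v = w"
      unfolding K by simp
  qed
qed

text \<open>The image of \<open>\<Phi>\<close> is itself one of the subrepresentations whose union
  spans the isotypic component.\<close>

lemma equivariant_image_isotypic:
  assumes "\<And>g u. g \<in> carrier G \<Longrightarrow> u \<in> hilb B \<Longrightarrow> \<sigma> g u \<in> hilb B" and "clin \<Phi>"
    and "\<And>g u. g \<in> carrier G \<Longrightarrow> u \<in> hilb B \<Longrightarrow> \<Phi> (\<sigma> g u) = R g (\<Phi> u)"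
    and "inj_on \<Phi> (hilb B)"
    and "\<Phi> ` hilb B \<subseteq> V" and "u \<in> hilb B"
  shows "\<Phi> u \<in> isotypic G V R (B, \<sigma>)"
proof -
  have "equivariant_iso G (hilb B) \<sigma> (\<Phi> ` hilb B) R"
    using assms unfolding equivariant_iso_def bij_betw_def by blast
  then have iso: "equivariant_iso G (\<Phi> ` hilb B) R (hilb B) \<sigma>"
    by (rule equivariant_iso_sym[OF _ subspace_hilb]) (rule assms(1))
  have "invariant_subspace G R (\<Phi> ` hilb B)"
    unfolding invariant_subspace_def
    using subspace_image[OF assms(2) subspace_hilb] assms(1)
    by (auto simp: assms(3)[symmetric])
  then show ?thesis
    unfolding isotypic_def using iso assms(5,6) by (auto intro!: cvs.span_base)
qed

text \<open>Besides the kernel, the image is invariant; being nonzero, it fills the irreducible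
  target.\<close>

lemma schur_iso:
  assumes "irrep G (B, \<sigma>)" and "irrep G (C, \<tau>)" and "clin \<Phi>"
    and "\<And>g u. g \<in> carrier G \<Longrightarrow> u \<in> hilb B \<Longrightarrow> \<Phi> (\<sigma> g u) = \<tau> g (\<Phi> u)"
    and "\<Phi> ` hilb B \<subseteq> hilb C" and "u \<in> hilb B" and "\<Phi> u \<noteq> 0"
  shows "rep_iso G (B, \<sigma>) (C, \<tau>)"
proof -
  have inj: "inj_on \<Phi> (hilb B)"
    using schur_injective[of G B \<sigma> "hilb C" \<tau> \<Phi> u] irrep_action[OF assms(2)] assms by blast
  have "invariant_subspace G \<tau> (\<Phi> ` hilb B)"
    unfolding invariant_subspace_def
    using subspace_image[OF assms(3) subspace_hilb] actionD(3)[OF irrep_action[OF assms(1)]]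
    by (auto simp: assms(4)[symmetric])
  moreover have "\<Phi> ` hilb B \<noteq> {0}"
    using assms(6,7) by auto
  ultimately have "\<Phi> ` hilb B = hilb C"
    using assms(2,5) unfolding irrep_def by blast
  then show ?thesis
    using inj assms(3,4) unfolding rep_iso_def equivariant_iso_def bij_betw_def by auto
qed

text \<open>
  For a fixed vector \<open>v\<close> and a fixed row \<open>a\<close> of matrix coefficients of \<open>\<sigma>\<close>, this map is equivariant.
  It does the work of the character projections, without the orthogonality relations.
\<close>

definition transfer_map ::
    "('g, 'm) monoid_scheme \<Rightarrow> ('g \<Rightarrow> 'i oper) \<Rightarrow> ('g \<Rightarrow> 'x oper) \<Rightarrow> 'i \<Rightarrow> 'x vect \<Rightarrow>
     'i vect \<Rightarrow> 'x vect"
  where "transfer_map G \<sigma> R a v u = (\<Sum>g\<in>carrier G. \<sigma> g u a *\<^sub>C R (inv\<^bsub>G\<^esub> g) v)"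

lemma sum_reindex_right_mult:
  assumes "group G" and "h \<in> carrier G"
  shows "(\<Sum>g\<in>carrier G. f (g \<otimes>\<^bsub>G\<^esub> h)) = (\<Sum>g\<in>carrier G. f g)"
proof -
  interpret group G by fact
  show ?thesis
    by (rule sum.reindex_bij_witness[of _ "\<lambda>g. g \<otimes>\<^bsub>G\<^esub> inv\<^bsub>G\<^esub> h" "\<lambda>g. g \<otimes>\<^bsub>G\<^esub> h"])
      (use assms(2) in \<open>auto simp: m_assoc\<close>)
qed

lemma transfer_map_clin:
  assumes "action G (hilb B) \<sigma>"
  shows "clin (transfer_map G \<sigma> R a v)"
  unfolding transfer_map_def by (intro clin_sumI clin_coord actionD(2)[OF assms])

lemma transfer_map_mem:
  assumes "group G" and "action G V R" and "v \<in> V"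
  shows "transfer_map G \<sigma> R a v u \<in> V"
  unfolding transfer_map_def
  using assms group.inv_closed[OF assms(1)]
  by (intro cvs.subspace_sum cvs.subspace_scale) (auto intro: actionD)

text \<open>Substituting \<open>g\<close> for the product of \<open>g\<close> and \<open>h\<close>
  moves \<open>h\<close> from the matrix coefficient to the action on \<open>v\<close>.\<close>

lemma transfer_map_equivariant:
  assumes "group G" and "action G (hilb B) \<sigma>" and "action G V R" and "v \<in> V"
    and "h \<in> carrier G" and "u \<in> hilb B"
  shows "transfer_map G \<sigma> R a v (\<sigma> h u) = R h (transfer_map G \<sigma> R a v u)"
proof -
  interpret group G by fact
  let ?f = "\<lambda>g. \<sigma> g u a *\<^sub>C R (h \<otimes>\<^bsub>G\<^esub> inv\<^bsub>G\<^esub> g) v"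
  have "transfer_map G \<sigma> R a v (\<sigma> h u) = (\<Sum>g\<in>carrier G. ?f (g \<otimes>\<^bsub>G\<^esub> h))"
    unfolding transfer_map_def
  proof (rule sum.cong)
    fix g assume g: "g \<in> carrier G"
    have "h \<otimes>\<^bsub>G\<^esub> inv\<^bsub>G\<^esub> (g \<otimes>\<^bsub>G\<^esub> h) = inv\<^bsub>G\<^esub> g"
      using g assms(5) by (simp add: inv_mult_group m_assoc[symmetric])
    then show "\<sigma> g (\<sigma> h u) a *\<^sub>C R (inv\<^bsub>G\<^esub> g) v = ?f (g \<otimes>\<^bsub>G\<^esub> h)"
      using actionD(5)[OF assms(2) g assms(5,6)] by simp
  qed simp
  also have "\<dots> = (\<Sum>g\<in>carrier G. ?f g)"
    by (rule sum_reindex_right_mult) fact+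
  also have "\<dots> = R h (transfer_map G \<sigma> R a v u)"
    unfolding transfer_map_def
    using assms actionD(2)[OF assms(3,5)] by (simp add: clin_sum clin_scale actionD(5)[OF assms(3)])
  finally show ?thesis .
qed

text \<open>By Schur's lemma the equivariant map is either zero at \<open>u\<close> or injective,
  and in the second case its image is a copy of \<open>\<sigma>\<close>.\<close>

lemma transfer_map_isotypic:
  assumes "group G" and "irrep G (B, \<sigma>)" and "action G V R" and "v \<in> V" and "u \<in> hilb B"
  shows "transfer_map G \<sigma> R a v u \<in> isotypic G V R (B, \<sigma>)"
proof (cases "transfer_map G \<sigma> R a v u = 0")
  case True
  then show ?thesis
    by (simp add: isotypic_def cvs.span_zero)
next
  case False
  let ?\<Phi> = "transfer_map G \<sigma> R a v"
  note act = irrep_action[OF assms(2)]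
  have lin: "clin ?\<Phi>"
    by (rule transfer_map_clin[OF act])
  have eqv: "?\<Phi> (\<sigma> h w) = R h (?\<Phi> w)" if "h \<in> carrier G" "w \<in> hilb B" for h w
    using transfer_map_equivariant[of G B \<sigma> V R v h w a] assms(1,3,4) act that by blast
  have inj: "inj_on ?\<Phi> (hilb B)"
    using schur_injective[of G B \<sigma> V R ?\<Phi> u] assms(2,3,5) lin eqv False by blast
  have "?\<Phi> ` hilb B \<subseteq> V"
    using transfer_map_mem[OF assms(1,3,4)] by auto
  then show ?thesis
    using equivariant_image_isotypic[of G B \<sigma> ?\<Phi> R V u] actionD(3)[OF act] assms(5) lin eqv inj
    by blast
qed

text \<open>\<open>unitary_dual\<close> consists of representations on coordinates indexed by
  naturals. Numbering an orthonormal basis of an irreducible subspace transports the action there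
  and keeps it unitary.\<close>

lemma subspace_nat_model:
  fixes R :: "'g \<Rightarrow> 'x oper"
  assumes X: "finite X" and act: "action G V R" and VX: "V \<subseteq> hilb X"
    and unit: "\<And>g u v. g \<in> carrier G \<Longrightarrow> u \<in> V \<Longrightarrow> v \<in> V \<Longrightarrow> cinner X (R g u) (R g v) = cinner X u v"
    and nz: "V \<noteq> {0}"
    and min: "\<And>U. U \<subseteq> V \<Longrightarrow> invariant_subspace G R U \<Longrightarrow> U = {0} \<or> U = V"
  obtains d :: nat and s where "irrep G ({..<d}, s)" and "equivariant_iso G (hilb {..<d}) s V R"
proof -
  obtain E where E: "orthonormal X E" "cvs.span E = V" "E \<subseteq> V"
    using onb_exists[OF X actionD(1)[OF act] VX] .
  define d where "d = card E"
  have finE: "finite E" using E(1) by (simp add: orthonormal_def)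
  then obtain e where e: "bij_betw e {..<d} E"
    using ex_bij_betw_nat_finite[OF finE] by (auto simp: d_def lessThan_atLeast0)
  have eE: "e i \<in> E" if "i < d" for i
    using e that by (auto simp: bij_betw_def)
  have ee: "cinner X (e i) (e j) = (if i = j then 1 else 0)" if "i < d" "j < d" for i j
    using e eE that E(1) by (auto simp: orthonormal_def bij_betw_def inj_on_def)
  \<comment> \<open>\<open>T\<close> is the isometry that sends coordinates to vectors of
    \<open>V\<close>; \<open>L\<close> reads the coordinates off again and inverts \<open>T\<close>
    on \<open>V\<close>.\<close>
  define T :: "nat vect \<Rightarrow> 'x vect" where "T v = (\<Sum>i<d. v i *\<^sub>C e i)" for v
  define L :: "'x vect \<Rightarrow> nat vect" where "L u = (\<lambda>i. if i < d then cinner X (e i) u else 0)" for u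
  have linT: "clin T"
    by (rule clinI) (simp_all add: T_def vect_apply cvs.scale_left_distrib sum.distrib cvs.scale_sum_right)
  have linL: "clin L"
    by (rule clinI) (auto simp: L_def fun_eq_iff vect_apply cinner_add_right cinner_scale_right)
  have TV: "T v \<in> V" for v
    unfolding T_def using eE E(3) actionD(1)[OF act]
    by (intro cvs.subspace_sum cvs.subspace_scale) auto
  have LH: "L u \<in> hilb {..<d}" for u
    by (simp add: L_def hilb_def)
  have cT: "cinner X (e i) (T v) = v i" if "i < d" for i v
  proof -
    have "cinner X (e i) (T v) = (\<Sum>j<d. v j * (if i = j then 1 else 0))"
      using that by (auto simp: T_def cinner_sum_right cinner_scale_right ee intro!: sum.cong)
    then show ?thesis using that by (simp add: if_distrib cong: if_cong)
  qed
  have LT: "L (T v) = v" if "v \<in> hilb {..<d}" for v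
    using that by (auto simp: L_def cT hilb_def fun_eq_iff)
  have TL: "T (L u) = u" if "u \<in> V" for u
  proof -
    have "T (L u) = (\<Sum>i<d. cinner X (e i) u *\<^sub>C e i)"
      by (simp add: T_def L_def)
    also have "\<dots> = expansion X E u"
      unfolding expansion_def by (rule sum.reindex_bij_betw[OF e])
    finally show ?thesis
      using expansion_id[OF X E(1), of u] E(2,3) VX that by auto
  qed
  have innerT: "cinner X (T u) (T v) = cinner {..<d} u v" for u v
  proof -
    have "cinner X (T u) (T v) = (\<Sum>i<d. cnj (u i) * cinner X (e i) (T v))"
      by (simp add: T_def[of u] cinner_sum_left cinner_scale_left)
    then show ?thesis
      by (simp add: cT cinner_def[of "{..<d}"])
  qed
  define s where "s g = (\<lambda>v. L (R g (T v)))" for g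
  have eqv: "T (s g v) = R g (T v)" if "g \<in> carrier G" for g v
    unfolding s_def by (rule TL[OF actionD(3)[OF act that TV]])
  have "unitary_rep G ({..<d}, s)"
    unfolding unitary_rep_def
  proof (simp, intro conjI ballI)
    fix g assume g: "g \<in> carrier G"
    show "clin (s g)"
      unfolding s_def by (intro clin_comp[OF linL] clin_comp[OF actionD(2)[OF act g] linT])
    show "s g ` hilb {..<d} \<subseteq> hilb {..<d}"
      using LH by (auto simp: s_def)
    show "cinner {..<d} (s g u) (s g v) = cinner {..<d} u v" for u v
      unfolding innerT[symmetric] eqv[OF g] by (rule unit[OF g TV TV])
    show "s (g \<otimes>\<^bsub>G\<^esub> h) v = s g (s h v)" if "h \<in> carrier G" for h v
      unfolding s_def[of "g \<otimes>\<^bsub>G\<^esub> h"] s_def[of g] eqv[OF that] actionD(5)[OF act g that TV] ..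
  next
    show "s \<one>\<^bsub>G\<^esub> v = v" if "v \<in> hilb {..<d}" for v
      unfolding s_def actionD(4)[OF act TV] by (rule LT[OF that])
  qed
  moreover have "hilb {..<d} \<noteq> {0}"
  proof
    assume "hilb {..<d} = {0}"
    then have "u = 0" if "u \<in> V" for u
      using TL[OF that] LH[of u] clin_0[OF linT] by auto
    then show False
      using nz actionD(1)[OF act] cvs.subspace_0 by blast
  qed
  moreover have "U = {0} \<or> U = hilb {..<d}" if U: "U \<subseteq> hilb {..<d}" "invariant_subspace G s U" for U
  proof -
    have "invariant_subspace G R (T ` U)"
      using U(2) subspace_image[OF linT] unfolding invariant_subspace_def
      by (auto simp: eqv[symmetric] image_subset_iff intro!: imageI)
    then have TU: "T ` U = {0} \<or> T ` U = V"
      using TV by (intro min) auto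
    have U': "U = L ` (T ` U)"
      using LT U(1) by (force simp: image_image)
    have "L ` V = hilb {..<d}"
    proof
      show "hilb {..<d} \<subseteq> L ` V"
        using LT TV by (metis image_eqI subsetI)
    qed (use LH in auto)
    then show ?thesis
      using TU U' clin_0[OF linL] by auto
  qed
  ultimately have "irrep G ({..<d}, s)"
    unfolding irrep_def by blast
  moreover have "equivariant_iso G (hilb {..<d}) s V R"
  proof -
    have "bij_betw T (hilb {..<d}) V"
      by (rule bij_betw_byWitness[where f' = L]) (use LT TL TV LH in auto)
    then show ?thesis
      using linT eqv unfolding equivariant_iso_def by blast
  qed
  ultimately show ?thesis
    by (rule that)
qed

section \<open>The regular representation\<close>

text \<open>The action that sends \<open>ket x\<close> to the basis vector at \<open>x\<close> times
  the inverse of \<open>g\<close>, written on coordinate functions. This form avoids sums over basis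
  vectors; \<open>basis_map_op_right_regular\<close> makes the connection.\<close>

definition right_regular :: "('g, 'm) monoid_scheme \<Rightarrow> 'g \<Rightarrow> 'g oper"
  where "right_regular G g v = (\<lambda>x. if x \<in> carrier G then v (x \<otimes>\<^bsub>G\<^esub> g) else 0)"

lemma right_regular_action:
  assumes "group G"
  shows "action G (hilb (carrier G)) (right_regular G)"
proof -
  interpret group G by fact
  show ?thesis
    unfolding action_def using subspace_hilb[of "carrier G"]
    by (auto simp: right_regular_def hilb_def fun_eq_iff vect_apply m_assoc intro!: clinI)
qed

lemma right_regular_unitary:
  assumes "group G" and "g \<in> carrier G"
  shows "cinner (carrier G) (right_regular G g u) (right_regular G g v) = cinner (carrier G) u v"
  unfolding cinner_def right_regular_def
  using sum_reindex_right_mult[OF assms, of "\<lambda>x. cnj (u x) * v x"] by simp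

definition matrix_coeff ::
    "('g, 'm) monoid_scheme \<Rightarrow> ('g, 'i) rep \<Rightarrow> 'i \<Rightarrow> 'i \<Rightarrow> 'g vect"
  where "matrix_coeff G \<sigma> a b = (\<lambda>x. if x \<in> carrier G then snd \<sigma> x (ket b) a else 0)"

definition coeff_index ::
    "('g, 'm) monoid_scheme \<Rightarrow> (('g, nat) rep set \<times> nat \<times> nat) set"
  where "coeff_index G =
    Sigma (unitary_dual G) (\<lambda>C. fst (class_rep C) \<times> fst (class_rep C))"

definition class_coeff ::
    "('g, 'm) monoid_scheme \<Rightarrow> ('g, nat) rep set \<times> nat \<times> nat \<Rightarrow> 'g vect"
  where "class_coeff G = (\<lambda>(C, a, b). matrix_coeff G (class_rep C) a b)"

text \<open>An equivariant map into functions on the group is determined by evaluation at the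
  identity: the value of \<open>\<Phi> u\<close> at \<open>x\<close> is the value of
  \<open>\<Phi> (\<sigma> x u)\<close> at the identity (Frobenius reciprocity).\<close>

lemma equivariant_into_regular:
  assumes "group G" and "action G (hilb B) \<sigma>" and "finite B" and "clin \<Phi>"
    and "\<And>g v. g \<in> carrier G \<Longrightarrow> v \<in> hilb B \<Longrightarrow> \<Phi> (\<sigma> g v) = right_regular G g (\<Phi> v)"
    and "u \<in> hilb B" and "\<Phi> u \<in> hilb (carrier G)"
  shows "\<Phi> u = (\<Sum>a\<in>B. \<Sum>b\<in>B. (u b * \<Phi> (ket a) \<one>\<^bsub>G\<^esub>) *\<^sub>C matrix_coeff G (B, \<sigma>) a b)"
proof
  fix x
  interpret group G by fact
  show "\<Phi> u x = (\<Sum>a\<in>B. \<Sum>b\<in>B. (u b * \<Phi> (ket a) \<one>\<^bsub>G\<^esub>) *\<^sub>C matrix_coeff G (B, \<sigma>) a b) x"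
  proof (cases "x \<in> carrier G")
    case True
    have "\<Phi> u x = right_regular G x (\<Phi> u) \<one>\<^bsub>G\<^esub>"
      using True by (simp add: right_regular_def)
    also have "\<dots> = \<Phi> (\<sigma> x u) \<one>\<^bsub>G\<^esub>"
      using assms(5)[OF True assms(6)] by simp
    also have "\<dots> = (\<Sum>a\<in>B. \<sigma> x u a * \<Phi> (ket a) \<one>\<^bsub>G\<^esub>)"
      by (rule clin_apply_expand[OF assms(3,4) actionD(3)[OF assms(2) True assms(6)]])
    also have "\<dots> = (\<Sum>a\<in>B. (\<Sum>b\<in>B. u b * \<sigma> x (ket b) a) * \<Phi> (ket a) \<one>\<^bsub>G\<^esub>)"
      using clin_apply_expand[OF assms(3) actionD(2)[OF assms(2) True] assms(6)] by simp
    also have "\<dots> = (\<Sum>a\<in>B. \<Sum>b\<in>B. (u b * \<Phi> (ket a) \<one>\<^bsub>G\<^esub>) * \<sigma> x (ket b) a)"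
      by (simp add: sum_distrib_left sum_distrib_right mult_ac)
    finally show ?thesis
      using True by (simp add: vect_apply matrix_coeff_def)
  next
    case False
    then show ?thesis
      using assms(7) by (simp add: vect_apply matrix_coeff_def hilb_def)
  qed
qed

text \<open>Induction on the dimension. A reducible \<open>V\<close> splits into an invariant
  subspace and its orthogonal complement; an irreducible \<open>V\<close> is the image of a class
  representative, to which \<open>equivariant_into_regular\<close> applies.\<close>

lemma invariant_subspace_coeff_span:
  assumes G: "group G" and fin: "finite (carrier G)"
    and "V \<subseteq> hilb (carrier G)" and "invariant_subspace G (right_regular G) V"
  shows "V \<subseteq> cvs.span (class_coeff G ` coeff_index G)"
  using assms(3,4)
proof (induction "cvs.dim V" arbitrary: V rule: less_induct)
  case less
  let ?X = "carrier G" and ?R = "right_regular G"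
  let ?M = "cvs.span (class_coeff G ` coeff_index G)"
  interpret group G by fact
  have sV: "cvs.subspace V" and inv: "\<And>g v. g \<in> ?X \<Longrightarrow> v \<in> V \<Longrightarrow> ?R g v \<in> V"
    using less.prems(2) unfolding invariant_subspace_def by auto
  note act = right_regular_action[OF G]
  have actV: "action G V ?R"
    unfolding action_def using sV inv less.prems(1) actionD(2,4,5)[OF act] by (auto simp: subset_eq)
  consider "V = {0}" | U where "U \<subseteq> V" "invariant_subspace G ?R U" "U \<noteq> {0}" "U \<noteq> V"
    | "V \<noteq> {0}" "\<And>U. U \<subseteq> V \<Longrightarrow> invariant_subspace G ?R U \<Longrightarrow> U = {0} \<or> U = V"
    by blast
  then show ?case
  proof cases
    case 1
    then show ?thesis by (simp add: cvs.span_zero)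
  next
    case 2
    have UX: "U \<subseteq> hilb ?X" using 2(1) less.prems(1) by auto
    have sU: "cvs.subspace U" and invU: "\<And>g v. g \<in> ?X \<Longrightarrow> v \<in> U \<Longrightarrow> ?R g v \<in> U"
      using 2(2) unfolding invariant_subspace_def by auto
    \<comment> \<open>The orthogonal complement of \<open>U\<close> in \<open>V\<close>, invariant
      because the regular representation is unitary.\<close>
    define U' where "U' = {v\<in>V. \<forall>u\<in>U. cinner ?X u v = 0}"
    have sU': "cvs.subspace U'"
      using sV unfolding U'_def cvs.subspace_def
      by (auto simp: cinner_zero_right cinner_add_right cinner_scale_right)
    have invU': "?R g v \<in> U'" if g: "g \<in> ?X" and v: "v \<in> U'" for g v
    proof -
      have "cinner ?X u (?R g v) = 0" if u: "u \<in> U" for u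
      proof -
        have "?R g (?R (inv\<^bsub>G\<^esub> g) u) = u"
          using actionD(5)[OF act g inv_closed[OF g]] actionD(4)[OF act] u UX g by (simp add: subset_eq)
        then have "cinner ?X u (?R g v) = cinner ?X (?R (inv\<^bsub>G\<^esub> g) u) v"
          using right_regular_unitary[OF G g] by metis
        then show ?thesis
          using v invU[OF inv_closed[OF g] u] by (simp add: U'_def)
      qed
      then show ?thesis
        using v inv[OF g] by (simp add: U'_def)
    qed
    obtain u where u: "u \<in> U" "u \<noteq> 0"
      using 2(3) cvs.subspace_0[OF sU] by auto
    then have "u \<notin> U'"
      using cinner_self_eq_0[OF fin, of u] UX by (auto simp: U'_def)
    then have U'V: "U' \<subset> V"
      using u 2(1) by (auto simp: U'_def)
    have UM: "U \<subseteq> ?M"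
      using less.hyps[OF dim_strict_mono[OF fin sU sV _ less.prems(1)] UX 2(2)] 2(1,4) by blast
    have U'M: "U' \<subseteq> ?M"
      using less.hyps[OF dim_strict_mono[OF fin sU' sV U'V less.prems(1)]] U'V less.prems(1)
        sU' invU' by (auto simp: invariant_subspace_def)
    show ?thesis
    proof
      fix v assume v: "v \<in> V"
      obtain E where E: "orthonormal ?X E" "cvs.span E = U"
        using onb_exists[OF fin sU UX] by blast
      have p: "expansion ?X E v \<in> U"
        using expansion_in_span E(2) by blast
      have "v - expansion ?X E v \<in> U'"
      proof -
        have "cinner ?X w (v - expansion ?X E v) = 0" if "w \<in> U" for w
          using that unfolding E(2)[symmetric]
          by (rule orth_span[rotated]) (simp add: cinner_diff_right cinner_expansion[OF E(1)])
        then show ?thesis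
          using v p 2(1) cvs.subspace_diff[OF sV] by (auto simp: U'_def)
      qed
      then have "(v - expansion ?X E v) + expansion ?X E v \<in> ?M"
        using U'M UM p by (intro cvs.span_add) auto
      then show "v \<in> ?M" by simp
    qed
  next
    case 3
    \<comment> \<open>The irreducible subspace is carried first to natural coordinates and then to
      the chosen representative of its class, so that its matrix coefficients belong to the indexed
      family.\<close>
    obtain d :: nat and s where s: "irrep G ({..<d}, s)" "equivariant_iso G (hilb {..<d}) s V ?R"
      using subspace_nat_model[OF fin actV less.prems(1) _ 3] right_regular_unitary[OF G] by blast
    obtain C where C: "C \<in> unitary_dual G" "rep_iso G (class_rep C) ({..<d}, s)"
      using unitary_dual_class[OF s(1)] .
    obtain B \<sigma> where B: "class_rep C = (B, \<sigma>)"
      by fastforce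
    have irr: "irrep G (B, \<sigma>)"
      using class_rep_irrep[OF C(1)] B by simp
    have "equivariant_iso G (hilb B) \<sigma> V ?R"
      using C(2) equivariant_iso_trans[OF _ s(2)] unfolding B rep_iso_def by simp
    then obtain T where T: "clin T" "bij_betw T (hilb B) V"
      "\<And>g v. g \<in> ?X \<Longrightarrow> v \<in> hilb B \<Longrightarrow> T (\<sigma> g v) = ?R g (T v)"
      by (auto simp: equivariant_iso_def)
    show ?thesis
    proof
      fix v assume v: "v \<in> V"
      then obtain u where u: "u \<in> hilb B" "v = T u"
        using T(2) by (auto simp: bij_betw_def)
      have "v = (\<Sum>a\<in>B. \<Sum>b\<in>B. (u b * T (ket a) \<one>\<^bsub>G\<^esub>) *\<^sub>C matrix_coeff G (B, \<sigma>) a b)"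
        using equivariant_into_regular[of G B \<sigma> T u] G irrep_action[OF irr] irrep_finite[OF irr] T u v
          less.prems(1) by blast
      also have "\<dots> \<in> ?M"
      proof (intro cvs.span_sum cvs.span_scale cvs.span_base)
        fix a b assume "a \<in> B" "b \<in> B"
        then have "(C, a, b) \<in> coeff_index G"
          using C(1) B by (simp add: coeff_index_def)
        then show "matrix_coeff G (B, \<sigma>) a b \<in> class_coeff G ` coeff_index G"
          using B by (force simp: class_coeff_def)
      qed
      finally show "v \<in> ?M" .
    qed
  qed
qed

text \<open>The whole regular representation is taken as the invariant subspace. The set
  \<open>J\<close> is finite because membership in a span uses finitely many vectors; finiteness of
  the dual is derived from this afterwards.\<close>

lemma peter_weyl:
  assumes "group G" and "finite (carrier G)" and "v \<in> hilb (carrier G)"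
  obtains J c where "finite J" and "J \<subseteq> coeff_index G"
    and "v = (\<Sum>j\<in>J. c j *\<^sub>C class_coeff G j)"
proof -
  have "invariant_subspace G (right_regular G) (hilb (carrier G))"
    using right_regular_action[OF assms(1)] unfolding invariant_subspace_def action_def by blast
  then have "v \<in> cvs.span (class_coeff G ` coeff_index G)"
    using invariant_subspace_coeff_span[OF assms(1,2) subset_refl] assms(3) by blast
  then obtain t r where t: "finite t" "t \<subseteq> class_coeff G ` coeff_index G" "v = (\<Sum>a\<in>t. r a *\<^sub>C a)"
    unfolding cvs.span_explicit by blast
  \<comment> \<open>One index is kept for each vector used, so that the sum over vectors becomes a
    sum over indices without repetition.\<close>
  obtain J where J: "J \<subseteq> coeff_index G" "inj_on (class_coeff G) J" "t = class_coeff G ` J"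
    using t(2) unfolding subset_image_inj by blast
  show ?thesis
  proof (rule that[of J "\<lambda>j. r (class_coeff G j)"])
    show "finite J"
      using t(1) J finite_image_iff by blast
    show "v = (\<Sum>j\<in>J. r (class_coeff G j) *\<^sub>C class_coeff G j)"
      using t(3) J by (simp add: sum.reindex)
  qed fact
qed

text \<open>The delta function at the identity expands in coefficients of finitely many classes, and
  every class must be among them: a nonzero term of the expansion gives a nonzero equivariant map
  between irreducible representations, hence an isomorphism.\<close>

lemma finite_unitary_dual:
  fixes G :: "('g, 'm) monoid_scheme"
  assumes "group G" and "finite (carrier G)"
  shows "finite (unitary_dual G)"
proof -
  interpret group G by fact
  obtain J c where J: "finite J" "J \<subseteq> coeff_index G"
    "ket \<one>\<^bsub>G\<^esub> = (\<Sum>j\<in>J. c j *\<^sub>C class_coeff G j)"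
    using peter_weyl[OF assms ket_in_hilb[OF one_closed]] .
  have "unitary_dual G \<subseteq> fst ` J"
  proof
    fix D assume D: "D \<in> unitary_dual G"
    obtain B \<tau> where B: "class_rep D = (B, \<tau>)" by fastforce
    have irr: "irrep G (B, \<tau>)"
      using class_rep_irrep[OF D] B by simp
    note act = irrep_action[OF irr]
    obtain a0 where a0: "a0 \<in> B" using irrep_nonempty[OF irr] by auto
    define v :: "nat vect" where "v = ket a0"
    have v: "v \<in> hilb B" "v \<noteq> 0"
      using ket_in_hilb[OF a0] by (auto simp: v_def ket_def fun_eq_iff vect_apply)
    \<comment> \<open>Applying the expansion of \<open>ket 1\<close> to \<open>\<tau>\<close> recovers \<open>v\<close>, so one of the classes in \<open>J\<close> maps nontrivially to \<open>\<tau>\<close>.\<close>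
    define t :: "('g, nat) rep set \<times> nat \<times> nat \<Rightarrow> nat vect"
      where "t = (\<lambda>(C, a, b). transfer_map G (snd (class_rep C)) \<tau> a v (ket b))"
    have "(\<Sum>j\<in>J. c j *\<^sub>C t j) = (\<Sum>j\<in>J. c j *\<^sub>C (\<Sum>x\<in>carrier G. class_coeff G j x *\<^sub>C \<tau> (inv\<^bsub>G\<^esub> x) v))"
      by (auto simp: t_def transfer_map_def class_coeff_def matrix_coeff_def intro!: sum.cong)
    also have "\<dots> = (\<Sum>j\<in>J. \<Sum>x\<in>carrier G. (c j * class_coeff G j x) *\<^sub>C \<tau> (inv\<^bsub>G\<^esub> x) v)"
      by (simp add: cvs.scale_sum_right)
    also have "\<dots> = (\<Sum>x\<in>carrier G. \<Sum>j\<in>J. (c j * class_coeff G j x) *\<^sub>C \<tau> (inv\<^bsub>G\<^esub> x) v)"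
      by (rule sum.swap)
    also have "\<dots> = (\<Sum>x\<in>carrier G. ket \<one>\<^bsub>G\<^esub> x *\<^sub>C \<tau> (inv\<^bsub>G\<^esub> x) v)"
      unfolding J(3) by (simp add: vect_apply cvs.scale_sum_left)
    also have "\<dots> = (\<Sum>x\<in>carrier G. if x = \<one>\<^bsub>G\<^esub> then \<tau> (inv\<^bsub>G\<^esub> x) v else 0)"
      by (rule sum.cong) (auto simp: ket_def)
    also have "\<dots> = v"
      using assms(2) actionD(4)[OF act v(1)] by simp
    finally have "(\<Sum>j\<in>J. c j *\<^sub>C t j) \<noteq> 0"
      using v(2) by simp
    then obtain j where j: "j \<in> J" "t j \<noteq> 0"
      by (metis (no_types, lifting) cvs.scale_zero_right sum.neutral)
    obtain C a b where Cab: "j = (C, a, b)" by (cases j)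
    obtain A \<sigma> where A: "class_rep C = (A, \<sigma>)" by fastforce
    have C: "C \<in> unitary_dual G" and b: "b \<in> A"
      using J(2) j(1) Cab A by (auto simp: coeff_index_def)
    have irrA: "irrep G (A, \<sigma>)"
      using class_rep_irrep[OF C] A by simp
    let ?\<Phi> = "transfer_map G \<sigma> \<tau> a v"
    have "clin ?\<Phi>"
      by (rule transfer_map_clin[OF irrep_action[OF irrA]])
    moreover have "?\<Phi> (\<sigma> g u) = \<tau> g (?\<Phi> u)" if "g \<in> carrier G" "u \<in> hilb A" for g u
      using transfer_map_equivariant[of G A \<sigma> "hilb B" \<tau> v g u a] assms(1) act
        irrep_action[OF irrA] v(1) that by blast
    moreover have "?\<Phi> ` hilb A \<subseteq> hilb B"
      by (intro image_subsetI transfer_map_mem[OF assms(1) act v(1)])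
    moreover have "?\<Phi> (ket b) \<noteq> 0"
      using j(2) Cab A by (simp add: t_def)
    ultimately have "rep_iso G (A, \<sigma>) (B, \<tau>)"
      using schur_iso[of G A \<sigma> B \<tau> ?\<Phi> "ket b"] irrA irr ket_in_hilb[OF b] by blast
    then have "C = D"
      using unitary_dual_eqI[OF C D] A B by simp
    then show "D \<in> fst ` J"
      using j(1) Cab by force
  qed
  then show ?thesis
    using J(1) finite_surj by blast
qed

section \<open>Diagonal right multiplication and coset states\<close>

lemma basis_map_op_right_regular:
  assumes "group P" and "finite (carrier P)" and "g \<in> carrier P"
    and "\<And>x. x \<in> carrier P \<Longrightarrow> f x = x \<otimes>\<^bsub>P\<^esub> inv\<^bsub>P\<^esub> g"
  shows "basis_map_op (carrier P) f = right_regular P g"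
proof (rule ext, rule ext)
  fix v y
  interpret group P by fact
  have eq: "y = f x \<longleftrightarrow> y \<in> carrier P \<and> x = y \<otimes>\<^bsub>P\<^esub> g" if "x \<in> carrier P" for x
    using that assms(3,4) by (auto simp: m_assoc)
  have "basis_map_op (carrier P) f v y = (\<Sum>x\<in>carrier P. if y = f x then v x else 0)"
    by (auto simp: basis_map_op_def vect_apply ket_def intro!: sum.cong)
  also have "\<dots> = (\<Sum>x\<in>carrier P. if y \<in> carrier P \<and> x = y \<otimes>\<^bsub>P\<^esub> g then v x else 0)"
    using eq by (intro sum.cong) auto
  also have "\<dots> = right_regular P g v y"
    using assms(2,3) by (cases "y \<in> carrier P") (auto simp: right_regular_def)
  finally show "basis_map_op (carrier P) f v y = right_regular P g v y" .
qed

lemma right_regular_ket: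
  assumes "group P" and "g \<in> carrier P" and "x \<in> carrier P"
  shows "right_regular P g (ket x) = ket (x \<otimes>\<^bsub>P\<^esub> inv\<^bsub>P\<^esub> g)"
proof -
  interpret group P by fact
  have "y \<otimes>\<^bsub>P\<^esub> g = x \<longleftrightarrow> y = x \<otimes>\<^bsub>P\<^esub> inv\<^bsub>P\<^esub> g" if "y \<in> carrier P" for y
    using that assms(2,3) by (auto simp: m_assoc)
  then show ?thesis
    using assms(2,3) by (auto simp: right_regular_def ket_def fun_eq_iff)
qed

lemma power_group_carrier: "carrier (power_group G k) = ({1..k} \<rightarrow>\<^sub>E carrier G)"
  by (simp add: power_group_def)

lemma power_group_mult:
  "x \<otimes>\<^bsub>power_group G k\<^esub> y = (\<lambda>i\<in>{1..k}. x i \<otimes>\<^bsub>G\<^esub> y i)"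
  by (simp add: power_group_def)

lemma power_group_group: "group G \<Longrightarrow> group (power_group G k)"
  by (simp add: power_group_def)

lemma power_group_inv:
  "group G \<Longrightarrow> x \<in> carrier (power_group G k) \<Longrightarrow>
    inv\<^bsub>power_group G k\<^esub> x = (\<lambda>i\<in>{1..k}. inv\<^bsub>G\<^esub> (x i))"
  by (simp add: power_group_def)

lemma power_group_finite: "finite (carrier G) \<Longrightarrow> finite (carrier (power_group G k))"
  by (simp add: power_group_carrier finite_PiE)

lemma right_mult_eq:
  assumes "group G" and "finite (carrier G)" and "g \<in> carrier (power_group G k)"
  shows "right_mult G k g = right_regular (power_group G k) g"
  unfolding right_mult_def
  by (rule basis_map_op_right_regular)
    (use assms in \<open>auto simp: power_group_group power_group_finite power_group_mult power_group_inv
      intro!: restrict_ext\<close>)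

text \<open>A homomorphism from the group to its power. Along it, the diagonal action on the
  registers in \<open>I\<close> is a restriction of the right regular representation of the power
  group, so unitarity and invariance are inherited.\<close>

definition diag_embed :: "('g, 'm) monoid_scheme \<Rightarrow> nat \<Rightarrow> nat set \<Rightarrow> 'g \<Rightarrow> nat \<Rightarrow> 'g"
  where "diag_embed G k I g = (\<lambda>i\<in>{1..k}. if i \<in> I then g else \<one>\<^bsub>G\<^esub>)"

lemma diag_embed_closed:
  "group G \<Longrightarrow> g \<in> carrier G \<Longrightarrow> diag_embed G k I g \<in> carrier (power_group G k)"
  by (auto simp: diag_embed_def power_group_carrier group.is_monoid)

lemma diag_embed_mult:
  "group G \<Longrightarrow> g \<in> carrier G \<Longrightarrow> h \<in> carrier G \<Longrightarrow>
    diag_embed G k I (g \<otimes>\<^bsub>G\<^esub> h) = diag_embed G k I g \<otimes>\<^bsub>power_group G k\<^esub> diag_embed G k I h"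
  by (auto simp: diag_embed_def power_group_mult group.is_monoid intro!: restrict_ext)

lemma diag_embed_one: "diag_embed G k I \<one>\<^bsub>G\<^esub> = \<one>\<^bsub>power_group G k\<^esub>"
  by (auto simp: diag_embed_def power_group_def intro!: restrict_ext)

lemma diag_right_mult_eq:
  assumes "group G" and "finite (carrier G)" and "g \<in> carrier G"
  shows "diag_right_mult G k I g = right_regular (power_group G k) (diag_embed G k I g)"
  unfolding diag_right_mult_def
proof (rule basis_map_op_right_regular)
  fix x assume "x \<in> carrier (power_group G k)"
  then have "x i \<in> carrier G" if "i \<in> {1..k}" for i
    using that by (auto simp: power_group_carrier)
  then show "(\<lambda>i\<in>{1..k}. if i \<in> I then x i \<otimes>\<^bsub>G\<^esub> inv\<^bsub>G\<^esub> g else x i) =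
      x \<otimes>\<^bsub>power_group G k\<^esub> inv\<^bsub>power_group G k\<^esub> diag_embed G k I g"
    unfolding power_group_inv[OF assms(1) diag_embed_closed[OF assms(1,3)]]
    by (auto simp: power_group_mult diag_embed_def group.is_monoid monoid.inv_one[OF group.is_monoid[OF assms(1)]] assms(1) intro!: restrict_ext)
qed (use assms in \<open>auto simp: power_group_group power_group_finite diag_embed_closed\<close>)

lemma action_cong:
  assumes "action G V S" and "\<And>g. g \<in> carrier G \<Longrightarrow> R g = S g"
    and "group G"
  shows "action G V R"
proof -
  interpret group G by fact
  show ?thesis
    using assms(1) unfolding action_def by (simp add: assms(2))
qed

lemma right_mult_action:
  assumes "group G" and "finite (carrier G)"
  shows "action (power_group G k) (hilb (carrier (power_group G k))) (right_mult G k)"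
  by (rule action_cong[OF right_regular_action[OF power_group_group[OF assms(1)]]])
    (simp_all add: right_mult_eq assms power_group_group)

lemma diag_right_mult_action:
  assumes "group G" and "finite (carrier G)"
  shows "action G (hilb (carrier (power_group G k))) (diag_right_mult G k I)"
proof (rule action_cong[OF _ diag_right_mult_eq[OF assms] assms(1)])
  note act = right_regular_action[OF power_group_group[OF assms(1)], of k]
  show "action G (hilb (carrier (power_group G k)))
      (\<lambda>g. right_regular (power_group G k) (diag_embed G k I g))"
    unfolding action_def
    using diag_embed_closed[OF assms(1)] actionD[OF act]
    by (auto simp: diag_embed_mult[OF assms(1)] diag_embed_one)
qed

section \<open>Part (a): isotypic vectors are orthogonal to coset states\<close>

lemma isotypic_subset: "cvs.subspace V \<Longrightarrow> isotypic G V R \<eta> \<subseteq> V"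
  unfolding isotypic_def by (rule cvs.span_minimal) auto

lemma isotypic_subspace: "cvs.subspace (isotypic G V R \<eta>)"
  unfolding isotypic_def by (rule cvs.subspace_span)

lemma isotypic_invariant:
  assumes "action G V R" and "g \<in> carrier G" and "v \<in> isotypic G V R \<eta>"
  shows "R g v \<in> isotypic G V R \<eta>"
proof -
  let ?S = "\<Union>{U. U \<subseteq> V \<and> invariant_subspace G R U \<and>
    equivariant_iso G U R (hilb (fst \<eta>)) (snd \<eta>)}"
  have "R g u \<in> ?S" if "u \<in> ?S" for u
    using that assms(2) unfolding invariant_subspace_def by blast
  then have "R g ` ?S \<subseteq> cvs.span ?S"
    using cvs.span_superset[of ?S] by blast
  then have "R g ` isotypic G V R \<eta> \<subseteq> isotypic G V R \<eta>"
    unfolding isotypic_def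
    by (rule span_image_subset[OF actionD(2)[OF assms(1,2)] _ cvs.subspace_span])
  then show ?thesis using assms(3) by auto
qed

text \<open>On a copy of \<open>\<eta>\<close> the intertwiner carries the sum over \<open>H\<close>
  to the corresponding sum for \<open>\<eta>\<close>, which vanishes; injectivity and linearity do
  the rest.\<close>

lemma isotypic_sum_zero:
  assumes "action G V R" and "H \<subseteq> carrier G"
    and "\<And>w. w \<in> hilb (fst \<eta>) \<Longrightarrow> (\<Sum>h\<in>H. snd \<eta> h w) = 0"
    and "v \<in> isotypic G V R \<eta>"
  shows "(\<Sum>h\<in>H. R h v) = 0"
proof -
  let ?f = "\<lambda>v. \<Sum>h\<in>H. R h v"
  have lin: "clin ?f"
    using assms(2) by (intro clin_sumI actionD(2)[OF assms(1)]) auto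
  have "?f u = 0" if U: "invariant_subspace G R U" "equivariant_iso G U R (hilb (fst \<eta>)) (snd \<eta>)"
    and u: "u \<in> U" for U u
  proof -
    obtain T where T: "clin T" "bij_betw T U (hilb (fst \<eta>))"
      "\<And>g v. g \<in> carrier G \<Longrightarrow> v \<in> U \<Longrightarrow> T (R g v) = snd \<eta> g (T v)"
      using U(2) by (auto simp: equivariant_iso_def)
    have sU: "cvs.subspace U"
      using U(1) by (simp add: invariant_subspace_def)
    have "T (?f u) = (\<Sum>h\<in>H. snd \<eta> h (T u))"
      unfolding clin_sum[OF T(1)] using assms(2) u by (auto simp: T(3) intro!: sum.cong)
    also have "\<dots> = 0"
      using assms(3) bij_betwE[OF T(2)] u by blast
    finally have "T (?f u) = T 0"
      by (simp add: clin_0[OF T(1)])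
    moreover have "?f u \<in> U"
      using U(1) u assms(2) by (intro cvs.subspace_sum[OF sU]) (auto simp: invariant_subspace_def)
    ultimately show "?f u = 0"
      using bij_betw_imp_inj_on[OF T(2)] cvs.subspace_0[OF sU] by (auto dest: inj_onD)
  qed
  then have "?f ` isotypic G V R \<eta> \<subseteq> {0}"
    unfolding isotypic_def by (intro span_image_subset[OF lin]) auto
  then show ?thesis using assms(4) by auto
qed

text \<open>The sum over the conjugate subgroup is the sum over \<open>H\<close> conjugated by the
  operator of \<open>g\<close>.\<close>

lemma missing_harmonic_conj:
  assumes "group G" and "finite (carrier G)" and "subgroup H G" and "missing_harmonic G H \<eta>"
    and "g \<in> carrier G" and "w \<in> hilb (fst \<eta>)"
  shows "(\<Sum>h\<in>(\<lambda>h. g \<otimes>\<^bsub>G\<^esub> h \<otimes>\<^bsub>G\<^esub> inv\<^bsub>G\<^esub> g) ` H. snd \<eta> h w) = 0"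
proof -
  interpret group G by fact
  obtain B \<sigma> where e: "\<eta> = (B, \<sigma>)" by fastforce
  have act: "action G (hilb B) \<sigma>"
    using assms(4) irrep_action unfolding missing_harmonic_def e by blast
  have HG: "H \<subseteq> carrier G"
    by (rule subgroup.subset[OF assms(3)])
  \<comment> \<open>In HOL \<open>1 / 0 = 0\<close>, so the normalising factor in
    \<open>missing_harmonic\<close> can be cancelled only once \<open>card H\<close> is known to be
    nonzero.\<close>
  have H0: "card H \<noteq> 0"
    using finite_subset[OF HG assms(2)] subgroup.one_closed[OF assms(3)] by auto
  have zero: "(\<Sum>h\<in>H. \<sigma> h v) = 0" if "v \<in> hilb B" for v
  proof -
    have "(1 / of_nat (card H)) *\<^sub>C (\<Sum>h\<in>H. \<sigma> h v) = 0"
      using assms(4) that unfolding missing_harmonic_def e by auto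
    moreover have "1 / of_nat (card H) \<noteq> (0 :: complex)"
      using H0 by (metis divide_eq_0_iff of_nat_eq_0_iff one_neq_zero)
    ultimately show ?thesis
      using cvs.scale_eq_0_iff by blast
  qed
  let ?u = "\<sigma> (inv\<^bsub>G\<^esub> g) w"
  have u: "?u \<in> hilb B"
    using actionD(3)[OF act] assms(5,6) e by simp
  have inj: "inj_on (\<lambda>h. g \<otimes>\<^bsub>G\<^esub> h \<otimes>\<^bsub>G\<^esub> inv\<^bsub>G\<^esub> g) H"
    using HG assms(5) by (intro inj_onI) (auto simp: subset_eq)
  have "(\<Sum>h\<in>(\<lambda>h. g \<otimes>\<^bsub>G\<^esub> h \<otimes>\<^bsub>G\<^esub> inv\<^bsub>G\<^esub> g) ` H. \<sigma> h w) = (\<Sum>h\<in>H. \<sigma> (g \<otimes>\<^bsub>G\<^esub> h \<otimes>\<^bsub>G\<^esub> inv\<^bsub>G\<^esub> g) w)"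
    by (simp add: sum.reindex[OF inj])
  also have "\<dots> = (\<Sum>h\<in>H. \<sigma> g (\<sigma> h ?u))"
  proof (rule sum.cong)
    fix h assume "h \<in> H"
    then have h: "h \<in> carrier G" using HG by auto
    have w: "w \<in> hilb B" using assms(6) e by simp
    show "\<sigma> (g \<otimes>\<^bsub>G\<^esub> h \<otimes>\<^bsub>G\<^esub> inv\<^bsub>G\<^esub> g) w = \<sigma> g (\<sigma> h ?u)"
      using actionD(5)[OF act _ _ w, of "g \<otimes>\<^bsub>G\<^esub> h" "inv\<^bsub>G\<^esub> g"] actionD(5)[OF act assms(5) h u] h assms(5)
      by simp
  qed simp
  also have "\<dots> = 0"
    using clin_sum[OF actionD(2)[OF act assms(5)]] zero[OF u] clin_0[OF actionD(2)[OF act assms(5)]]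
    by metis
  finally show ?thesis by (simp add: e)
qed

text \<open>Right multiplication by an element of \<open>K\<close> permutes the elements of each
  left coset of \<open>K\<close>.\<close>

lemma coset_state_right_invariant:
  assumes "group G" and "subgroup K G" and "c \<in> carrier G" and "x \<in> carrier G" and "h \<in> K"
  shows "coset_state G K c (x \<otimes>\<^bsub>G\<^esub> h) = coset_state G K c x"
proof -
  interpret group G by fact
  interpret K: subgroup K G by fact
  have "(\<Sum>h'\<in>K. ket (c \<otimes>\<^bsub>G\<^esub> h') (x \<otimes>\<^bsub>G\<^esub> h)) = (\<Sum>h'\<in>K. ket (c \<otimes>\<^bsub>G\<^esub> h') x)"
  proof (rule sum.reindex_bij_witness[of _ "\<lambda>h'. h' \<otimes>\<^bsub>G\<^esub> h" "\<lambda>h'. h' \<otimes>\<^bsub>G\<^esub> inv\<^bsub>G\<^esub> h"])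
    fix h' assume h': "h' \<in> K"
    have "x = c \<otimes>\<^bsub>G\<^esub> (h' \<otimes>\<^bsub>G\<^esub> inv\<^bsub>G\<^esub> h) \<longleftrightarrow> x \<otimes>\<^bsub>G\<^esub> h = c \<otimes>\<^bsub>G\<^esub> h'"
      using h' assms(3-5) K.mem_carrier by (metis inv_closed inv_solve_right m_assoc m_closed)
    then show "ket (c \<otimes>\<^bsub>G\<^esub> (h' \<otimes>\<^bsub>G\<^esub> inv\<^bsub>G\<^esub> h)) x = ket (c \<otimes>\<^bsub>G\<^esub> h') (x \<otimes>\<^bsub>G\<^esub> h)"
      by (simp add: ket_def)
  qed (use assms(5) in \<open>auto simp: m_assoc\<close>)
  then show ?thesis
    by (simp add: coset_state_def vect_apply)
qed

lemma coset_density_right_invariant: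
  assumes "group G" and "subgroup K G" and "x \<in> carrier G" and "h \<in> K"
  shows "coset_density G K v (x \<otimes>\<^bsub>G\<^esub> h) = coset_density G K v x"
  using coset_state_right_invariant[OF assms(1,2) _ assms(3,4)]
  by (simp add: coset_density_def ketbra_def vect_apply)

text \<open>In each register of \<open>I\<close> the row index of the density matrix may be
  multiplied by an element of \<open>K\<close> without changing the entry. Hence every vector in the
  range is fixed, whatever \<open>I\<close> is.\<close>

lemma coset_density_power_invariant:
  assumes "group G" and "finite (carrier G)" and "subgroup K G" and "h \<in> K"
  shows "diag_right_mult G k I h (coset_density_power G k K v) = coset_density_power G k K v"
proof
  fix x
  interpret group G by fact
  interpret K: subgroup K G by fact
  let ?P = "power_group G k" and ?w = "coset_density_power G k K v"
  have h: "h \<in> carrier G" by (rule K.mem_carrier[OF assms(4)])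
  have e: "diag_embed G k I h \<in> carrier ?P"
    by (rule diag_embed_closed[OF assms(1) h])
  show "diag_right_mult G k I h ?w x = ?w x"
  proof (cases "x \<in> carrier ?P")
    case True
    let ?y = "x \<otimes>\<^bsub>?P\<^esub> diag_embed G k I h"
    have y: "?y \<in> carrier ?P"
      using monoid.m_closed[OF group.is_monoid[OF power_group_group[OF assms(1)]] True e] .
    have xc: "x i \<in> carrier G" if "i \<in> {1..k}" for i
      using True that by (auto simp: power_group_carrier)
    have "coset_density G K u (?y i) = coset_density G K u (x i)" if "i \<in> {1..k}" for i u
      using that xc[OF that] coset_density_right_invariant[OF assms(1,3) xc[OF that] assms(4)]
      by (auto simp: power_group_mult diag_embed_def)
    then have "?w ?y = ?w x"
      using True y unfolding coset_density_power_def tensor_op_def power_group_carrier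
      by (auto intro!: sum.cong prod.cong)
    then show ?thesis
      using True by (simp add: diag_right_mult_eq assms h right_regular_def)
  next
    case False
    then show ?thesis
      by (simp add: diag_right_mult_eq assms h right_regular_def coset_density_power_def
          tensor_op_def power_group_carrier)
  qed
qed

lemma W_span_subset: "W_span G k \<eta> \<sigma> \<subseteq> hilb (carrier (power_group G k))"
  unfolding W_span_def W_reg_def
  by (rule cvs.span_minimal[OF _ subspace_hilb]) (use isotypic_subset[OF subspace_hilb] in blast)

text \<open>Summed over \<open>K\<close>, the inner products of the translates of \<open>u\<close>
  with \<open>?w\<close> give 0, since the translates add up to 0. By unitarity and invariance of
  \<open>?w\<close> each of them equals the inner product of \<open>u\<close> with
  \<open>?w\<close>, which therefore vanishes.\<close>

lemma Proj_W_coset_zero: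
  assumes "group G" and "finite (carrier G)" and "subgroup K G"
    and zero: "\<And>w. w \<in> hilb (fst \<eta>) \<Longrightarrow> (\<Sum>h\<in>K. snd \<eta> h w) = 0"
  shows "Proj_W G k \<eta> \<sigma> (coset_density_power G k K v) = 0"
proof -
  let ?X = "carrier (power_group G k)" and ?w = "coset_density_power G k K v"
  have KG: "K \<subseteq> carrier G"
    by (rule subgroup.subset[OF assms(3)])
  have K0: "card K \<noteq> 0"
    using finite_subset[OF KG assms(2)] subgroup.one_closed[OF assms(3)] by auto
  have reg: "cinner ?X u ?w = 0" if u: "u \<in> W_reg G k \<eta> \<sigma> I" for u I
  proof -
    have "(\<Sum>h\<in>K. diag_right_mult G k I h u) = 0"
      using isotypic_sum_zero[OF diag_right_mult_action[OF assms(1,2)] KG zero] u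
      unfolding W_reg_def by blast
    then have "0 = (\<Sum>h\<in>K. cinner ?X (diag_right_mult G k I h u) ?w)"
      by (simp add: cinner_sum_left[symmetric] cinner_zero_left)
    also have "\<dots> = (\<Sum>h\<in>K. cinner ?X u ?w)"
    proof (rule sum.cong)
      fix h assume h: "h \<in> K"
      then have hG: "h \<in> carrier G" using KG by auto
      have "cinner ?X (diag_right_mult G k I h u) ?w
          = cinner ?X (diag_right_mult G k I h u) (diag_right_mult G k I h ?w)"
        using coset_density_power_invariant[OF assms(1-3) h] by metis
      also have "\<dots> = cinner ?X u ?w"
        unfolding diag_right_mult_eq[OF assms(1,2) hG]
        by (rule right_regular_unitary[OF power_group_group[OF assms(1)] diag_embed_closed[OF assms(1) hG]])
      finally show "cinner ?X (diag_right_mult G k I h u) ?w = cinner ?X u ?w" .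
    qed simp
    finally show ?thesis
      using K0 by simp
  qed
  show ?thesis
    unfolding Proj_W_def
  proof (rule orth_proj_unique)
    show "finite ?X" by (rule power_group_finite[OF assms(2)])
    show "cvs.subspace (W_span G k \<eta> \<sigma>)" "0 \<in> W_span G k \<eta> \<sigma>"
      unfolding W_span_def by (auto intro: cvs.span_zero)
    show "cinner ?X u (?w - 0) = 0" if "u \<in> W_span G k \<eta> \<sigma>" for u
      using that unfolding W_span_def by (rule orth_span[rotated]) (use reg in auto)
  qed (rule W_span_subset)
qed

lemma prob_trivial_conjugate:
  assumes "group G" and "finite (carrier G)" and "subgroup H G" and "missing_harmonic G H \<eta>"
    and "g \<in> carrier G"
  shows "prob_trivial G k \<eta>
    (coset_density_power G k ((\<lambda>h. g \<otimes>\<^bsub>G\<^esub> h \<otimes>\<^bsub>G\<^esub> inv\<^bsub>G\<^esub> g) ` H)) = 0"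
proof -
  have "(\<lambda>h. g \<otimes>\<^bsub>G\<^esub> h \<otimes>\<^bsub>G\<^esub> inv\<^bsub>G\<^esub> g) ` H = g <#\<^bsub>G\<^esub> H #>\<^bsub>G\<^esub> inv\<^bsub>G\<^esub> g"
    by (auto simp: l_coset_def r_coset_def)
  then have "subgroup ((\<lambda>h. g \<otimes>\<^bsub>G\<^esub> h \<otimes>\<^bsub>G\<^esub> inv\<^bsub>G\<^esub> g) ` H) G"
    using group.subgroup_conjugation_is_surj2[OF assms(1,5,3)] by simp
  then show ?thesis
    unfolding prob_trivial_def op_trace_def o_def
    by (simp add: Proj_W_coset_zero[OF assms(1,2) _ missing_harmonic_conj[OF assms]] zero_fun_def)
qed

section \<open>Matrix coefficients of tensor products\<close>

lemma matrix_coeff_mult: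
  assumes "action G (hilb B) \<sigma>" and "finite B" and "x \<in> carrier G" and "y \<in> carrier G" and "b \<in> B"
  shows "\<sigma> (x \<otimes>\<^bsub>G\<^esub> y) (ket b) a = (\<Sum>c\<in>B. \<sigma> x (ket c) a * \<sigma> y (ket b) c)"
proof -
  have "\<sigma> (x \<otimes>\<^bsub>G\<^esub> y) (ket b) a = \<sigma> x (\<sigma> y (ket b)) a"
    using actionD(5)[OF assms(1,3,4) ket_in_hilb[OF assms(5)]] by simp
  also have "\<dots> = (\<Sum>c\<in>B. \<sigma> y (ket b) c * \<sigma> x (ket c) a)"
    using assms by (intro clin_apply_expand actionD[OF assms(1)] ket_in_hilb)
  finally show ?thesis by (simp add: mult.commute)
qed

text \<open>The coefficients in row \<open>a\<close> are linearly independent functions on the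
  group, and \<open>l\<close> is a dual family. It comes from a left inverse of the equivariant map
  that sends \<open>u\<close> to the function taking \<open>x\<close> to
  \<open>\<sigma> x u a\<close>, injective by Schur's lemma.\<close>

lemma matrix_coeff_row_left_inverse:
  assumes "group G" and "finite (carrier G)" and "irrep G (B, \<sigma>)" and "a \<in> B"
  obtains l where "\<And>b b'. b \<in> B \<Longrightarrow> b' \<in> B \<Longrightarrow>
    (\<Sum>x\<in>carrier G. l b x * \<sigma> x (ket b') a) = (if b = b' then 1 else 0)"
proof -
  interpret group G by fact
  define \<Phi> where "\<Phi> u = (\<lambda>x. if x \<in> carrier G then \<sigma> x u a else 0)" for u
  note act = irrep_action[OF assms(3)]
  have lin: "clin \<Phi>"
    by (rule clinI)
      (auto simp: \<Phi>_def fun_eq_iff vect_apply clin_add[OF actionD(2)[OF act]] clin_scale[OF actionD(2)[OF act]])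
  have eqv: "\<Phi> (\<sigma> g u) = right_regular G g (\<Phi> u)" if "g \<in> carrier G" "u \<in> hilb B" for g u
    using that by (auto simp: \<Phi>_def right_regular_def fun_eq_iff actionD(5)[OF act])
  \<comment> \<open>The value at the identity is a diagonal entry of the identity operator, which
    shows that the map is not zero.\<close>
  have "\<Phi> (ket a) \<one>\<^bsub>G\<^esub> = 1"
    using actionD(4)[OF act ket_in_hilb[OF assms(4)]] by (simp add: \<Phi>_def ket_def)
  then have "\<Phi> (ket a) \<noteq> 0"
    by (auto simp: vect_apply)
  then have "inj_on \<Phi> (hilb B)"
    using schur_injective[OF assms(3) right_regular_action[OF assms(1)] lin eqv ket_in_hilb[OF assms(4)]]
    by blast
  then obtain L where L: "clin L" "\<And>v. v \<in> hilb B \<Longrightarrow> L (\<Phi> v) = v"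
    using clin_left_inverse[OF lin subspace_hilb] by metis
  show ?thesis
  proof (rule that[of "\<lambda>b x. L (ket x) b"])
    fix b b' assume b: "b \<in> B" "b' \<in> B"
    have "\<Phi> (ket b') \<in> hilb (carrier G)"
      by (simp add: \<Phi>_def hilb_def)
    then have "L (\<Phi> (ket b')) b = (\<Sum>x\<in>carrier G. \<Phi> (ket b') x * L (ket x) b)"
      by (rule clin_apply_expand[OF assms(2) L(1)])
    then show "(\<Sum>x\<in>carrier G. L (ket x) b * \<sigma> x (ket b') a) = (if b = b' then 1 else 0)"
      using L(2)[OF ket_in_hilb[OF b(2)]] by (simp add: \<Phi>_def ket_def mult.commute)
  qed
qed

text \<open>Reading off row \<open>a\<close> of the tensor product representation is an injective
  equivariant map into functions on the power group. At \<open>ket b\<close> its value is the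
  product of coefficients in question.\<close>

lemma product_coeff_isotypic:
  fixes \<sigma> :: "nat \<Rightarrow> ('g, 'i) rep"
  assumes G: "group G" "finite (carrier G)"
    and irr: "\<And>i. i \<in> {1..k} \<Longrightarrow> irrep G (\<sigma> i)"
    and a: "a \<in> PiE {1..k} (\<lambda>i. fst (\<sigma> i))" and b: "b \<in> PiE {1..k} (\<lambda>i. fst (\<sigma> i))"
  shows "(\<lambda>x. if x \<in> carrier (power_group G k)
      then \<Prod>i\<in>{1..k}. matrix_coeff G (\<sigma> i) (a i) (b i) (x i) else 0)
    \<in> isotypic (power_group G k) (hilb (carrier (power_group G k))) (right_mult G k)
        (outer_tensor {1..k} \<sigma>)"
proof -
  let ?J = "{1..k}" and ?P = "power_group G k"
  let ?X = "carrier ?P"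
  define B where "B = (\<lambda>i. fst (\<sigma> i))"
  define s where "s = (\<lambda>i. snd (\<sigma> i))"
  have irr': "irrep G (B i, s i)" if "i \<in> ?J" for i
    using irr[OF that] by (simp add: B_def s_def)
  note act = irrep_action[OF irr'] and finB = irrep_finite[OF irr']
  define BB where "BB = PiE ?J B"
  define S where "S g = tensor_op ?J B (\<lambda>i. s i (g i))" for g :: "nat \<Rightarrow> 'g"
  have outer: "outer_tensor ?J \<sigma> = (BB, S)"
    by (simp add: outer_tensor_def B_def s_def BB_def S_def[abs_def])
  have aB: "a i \<in> B i" if "i \<in> ?J" for i
    using a that by (auto simp: B_def)
  have bB: "c i \<in> B i" if "c \<in> BB" "i \<in> ?J" for i c
    using that by (auto simp: BB_def)
  have xG: "x i \<in> carrier G" if "x \<in> ?X" "i \<in> ?J" for x i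
    using that by (auto simp: power_group_carrier)
  have finBB: "finite BB"
    unfolding BB_def by (intro finite_PiE) (auto intro: finB)
  \<comment> \<open>Row \<open>a\<close> of the matrix of the tensor product representation at
    \<open>x\<close>.\<close>
  define m where "m x c = (\<Prod>i\<in>?J. s i (x i) (ket (c i)) (a i))" for x c
  define \<Phi> where "\<Phi> u = (\<lambda>x. if x \<in> ?X then \<Sum>c\<in>BB. m x c * u c else 0)" for u :: "(nat \<Rightarrow> 'i) vect"
  have lin: "clin \<Phi>"
    by (rule clinI)
      (auto simp: \<Phi>_def fun_eq_iff vect_apply algebra_simps sum.distrib sum_distrib_left)
  \<comment> \<open>Multiplicativity of the tensor product: by the distributive law the sum over
    index tuples factors into one matrix product per register.\<close>
  have m_mult: "(\<Sum>c\<in>BB. m x c * (\<Prod>i\<in>?J. s i (g i) (ket (d i)) (c i))) = m (x \<otimes>\<^bsub>?P\<^esub> g) d"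
    if x: "x \<in> ?X" and g: "g \<in> ?X" and d: "d \<in> BB" for x g d
  proof -
    have "(\<Sum>c\<in>BB. m x c * (\<Prod>i\<in>?J. s i (g i) (ket (d i)) (c i)))
        = (\<Sum>c\<in>BB. \<Prod>i\<in>?J. s i (x i) (ket (c i)) (a i) * s i (g i) (ket (d i)) (c i))"
      by (simp add: m_def prod.distrib)
    also have "\<dots> = (\<Prod>i\<in>?J. \<Sum>c\<in>B i. s i (x i) (ket c) (a i) * s i (g i) (ket (d i)) c)"
      unfolding BB_def by (rule prod_sum_PiE[symmetric]) (auto intro: finB)
    also have "\<dots> = (\<Prod>i\<in>?J. s i (x i \<otimes>\<^bsub>G\<^esub> g i) (ket (d i)) (a i))"
      by (intro prod.cong refl matrix_coeff_mult[symmetric] act finB xG x g bB d)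
    also have "\<dots> = m (x \<otimes>\<^bsub>?P\<^esub> g) d"
      by (simp add: m_def power_group_mult)
    finally show ?thesis .
  qed
  have SBB: "S g u \<in> hilb BB" for g u
    by (simp add: S_def tensor_op_def hilb_def BB_def)
  have eqv: "\<Phi> (S g u) = right_mult G k g (\<Phi> u)" if g: "g \<in> ?X" for g u
  proof
    fix x
    show "\<Phi> (S g u) x = right_mult G k g (\<Phi> u) x"
    proof (cases "x \<in> ?X")
      case True
      have "\<Phi> (S g u) x = (\<Sum>c\<in>BB. \<Sum>d\<in>BB. m x c * (\<Prod>i\<in>?J. s i (g i) (ket (d i)) (c i)) * u d)"
        using True by (simp add: \<Phi>_def S_def tensor_op_def BB_def sum_distrib_left mult.assoc)
      also have "\<dots> = (\<Sum>d\<in>BB. (\<Sum>c\<in>BB. m x c * (\<Prod>i\<in>?J. s i (g i) (ket (d i)) (c i))) * u d)"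
        by (subst sum.swap) (simp add: sum_distrib_right)
      also have "\<dots> = (\<Sum>d\<in>BB. m (x \<otimes>\<^bsub>?P\<^esub> g) d * u d)"
        by (rule sum.cong) (simp_all only: m_mult[OF True g])
      also have "\<dots> = right_mult G k g (\<Phi> u) x"
        using True g monoid.m_closed[OF group.is_monoid[OF power_group_group[OF G(1)]] True g]
        by (simp add: right_mult_eq[OF G g] right_regular_def \<Phi>_def)
      finally show ?thesis .
    next
      case False
      then show ?thesis
        by (simp add: \<Phi>_def right_mult_eq[OF G g] right_regular_def)
    qed
  qed
  \<comment> \<open>Injectivity of \<open>\<Phi>\<close> from left inverses in each factor; irreducibility of the tensor product is not needed.\<close>
  have "\<exists>l. \<forall>c\<in>B i. \<forall>c'\<in>B i. (\<Sum>x\<in>carrier G. l c x * s i x (ket c') (a i)) = (if c = c' then 1 else 0)"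
    if i: "i \<in> ?J" for i
    using matrix_coeff_row_left_inverse[OF G irr'[OF i] aB[OF i]] by metis
  then obtain l where l: "(\<Sum>x\<in>carrier G. l i c x * s i x (ket c') (a i)) = (if c = c' then 1 else 0)"
    if "i \<in> ?J" "c \<in> B i" "c' \<in> B i" for i c c'
    by metis
  have delta: "(\<Sum>x\<in>?X. (\<Prod>i\<in>?J. l i (c i) (x i)) * m x d) = (if c = d then 1 else 0)"
    if c: "c \<in> BB" and d: "d \<in> BB" for c d
  proof -
    have "(\<Sum>x\<in>?X. (\<Prod>i\<in>?J. l i (c i) (x i)) * m x d)
        = (\<Sum>x\<in>?X. \<Prod>i\<in>?J. l i (c i) (x i) * s i (x i) (ket (d i)) (a i))"
      by (simp add: m_def prod.distrib)
    also have "\<dots> = (\<Prod>i\<in>?J. \<Sum>x\<in>carrier G. l i (c i) x * s i x (ket (d i)) (a i))"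
      unfolding power_group_carrier by (rule prod_sum_PiE[symmetric]) (auto intro: G)
    also have "\<dots> = (\<Prod>i\<in>?J. if c i = d i then 1 else 0)"
      by (intro prod.cong refl l bB c d)
    also have "\<dots> = (if c = d then 1 else 0)"
    proof (cases "c = d")
      case False
      then obtain i where "i \<in> ?J" "c i \<noteq> d i"
        using c d unfolding BB_def by (meson PiE_ext)
      then show ?thesis
        using False by (auto intro!: prod_zero)
    qed simp
    finally show ?thesis .
  qed
  have recover: "u c = (\<Sum>x\<in>?X. (\<Prod>i\<in>?J. l i (c i) (x i)) * \<Phi> u x)" if c: "c \<in> BB" for u c
  proof -
    have "(\<Sum>x\<in>?X. (\<Prod>i\<in>?J. l i (c i) (x i)) * \<Phi> u x)
        = (\<Sum>x\<in>?X. \<Sum>d\<in>BB. (\<Prod>i\<in>?J. l i (c i) (x i)) * m x d * u d)"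
      by (simp add: \<Phi>_def sum_distrib_left mult.assoc)
    also have "\<dots> = (\<Sum>d\<in>BB. (\<Sum>x\<in>?X. (\<Prod>i\<in>?J. l i (c i) (x i)) * m x d) * u d)"
      by (subst sum.swap) (simp add: sum_distrib_right)
    also have "\<dots> = (\<Sum>d\<in>BB. if c = d then u d else 0)"
      by (rule sum.cong) (simp_all only: delta[OF c] if_distrib[of "\<lambda>z. z * _"] mult_1_left mult_zero_left)
    also have "\<dots> = u c"
      using c finBB by simp
    finally show ?thesis by simp
  qed
  have inj: "inj_on \<Phi> (hilb BB)"
  proof (rule inj_onI, rule ext)
    fix u v c assume uv: "u \<in> hilb BB" "v \<in> hilb BB" "\<Phi> u = \<Phi> v"
    show "u c = v c"
    proof (cases "c \<in> BB")
      case True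
      show ?thesis
        unfolding recover[OF True, of u] recover[OF True, of v] uv(3) ..
    next
      case False
      then show ?thesis using uv(1,2) by (simp add: hilb_def)
    qed
  qed
  have "b \<in> BB"
    using b by (simp add: BB_def B_def)
  then have "\<Phi> (ket b) \<in> isotypic ?P (hilb ?X) (right_mult G k) (BB, S)"
    using SBB eqv by (intro equivariant_image_isotypic[OF _ lin _ inj]) (auto simp: \<Phi>_def hilb_def ket_def)
  moreover have "\<Phi> (ket b) = (\<lambda>x. if x \<in> ?X then \<Prod>i\<in>?J. matrix_coeff G (\<sigma> i) (a i) (b i) (x i) else 0)"
  proof
    fix x
    have "\<Phi> (ket b) x = m x b" if "x \<in> ?X"
      using that \<open>b \<in> BB\<close> finBB by (simp add: \<Phi>_def ket_def if_distrib[of "\<lambda>z. _ * z"] cong: if_cong)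
    then show "\<Phi> (ket b) x = (if x \<in> ?X then \<Prod>i\<in>?J. matrix_coeff G (\<sigma> i) (a i) (b i) (x i) else 0)"
      using xG by (auto simp: \<Phi>_def m_def s_def matrix_coeff_def intro!: prod.cong)
  qed
  ultimately show ?thesis
    unfolding outer by simp
qed

abbreviation weak_space ::
    "('g, 'm) monoid_scheme \<Rightarrow> nat \<Rightarrow> (nat \<Rightarrow> ('g, nat) rep set) \<Rightarrow> (nat \<Rightarrow> 'g) vect set"
  where "weak_space G k \<sigma> \<equiv> isotypic (power_group G k) (hilb (carrier (power_group G k)))
    (right_mult G k) (outer_tensor {1..k} (\<lambda>i. class_rep (\<sigma> i)))"

text \<open>A basis vector of the power is a product of basis vectors. Each factor is expanded by
  \<open>peter_weyl\<close> and the product is multiplied out; every term is a product of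
  coefficients and lies in a single weak sampling space.\<close>

lemma ket_weak_decomposition:
  fixes G :: "('g, 'm) monoid_scheme"
  assumes G: "group G" "finite (carrier G)" and x: "x \<in> carrier (power_group G k)"
  obtains F and c :: "(nat \<Rightarrow> ('g, nat) rep set \<times> nat \<times> nat) \<Rightarrow> complex" and w \<sigma>
  where "finite F" and "ket x = (\<Sum>f\<in>F. c f *\<^sub>C w f)"
    and "\<forall>f\<in>F. \<sigma> f \<in> {1..k} \<rightarrow>\<^sub>E unitary_dual G \<and> w f \<in> weak_space G k (\<sigma> f)"
proof -
  let ?J = "{1..k}" and ?X = "carrier (power_group G k)"
  have xG: "y i \<in> carrier G" if "y \<in> ?X" "i \<in> ?J" for y i
    using that by (auto simp: power_group_carrier)
  \<comment> \<open>The pair \<open>q\<close> bundles an index set with its coefficients, so that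
    one application of choice selects both for each register.\<close>
  define Q where "Q i q \<longleftrightarrow> finite (fst q) \<and> fst q \<subseteq> coeff_index G \<and>
      ket (x i) = (\<Sum>j\<in>fst q. snd q j *\<^sub>C class_coeff G j)" for i q
  have "\<forall>i\<in>?J. \<exists>q. Q i q"
  proof
    fix i assume i: "i \<in> ?J"
    obtain J c where "finite J" "J \<subseteq> coeff_index G" "ket (x i) = (\<Sum>j\<in>J. c j *\<^sub>C class_coeff G j)"
      by (rule peter_weyl[OF G ket_in_hilb[OF xG[OF x i]]])
    then show "\<exists>q. Q i q"
      unfolding Q_def by (intro exI[of _ "(J, c)"]) simp
  qed
  then obtain q where q: "\<forall>i\<in>?J. Q i (q i)"
    by (rule bchoice[THEN exE])
  define J where "J i = fst (q i)" for i
  define c where "c i = snd (q i)" for i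
  have J: "\<And>i. i \<in> ?J \<Longrightarrow> finite (J i)" "\<And>i. i \<in> ?J \<Longrightarrow> J i \<subseteq> coeff_index G"
    and c: "\<And>i. i \<in> ?J \<Longrightarrow> ket (x i) = (\<Sum>j\<in>J i. c i j *\<^sub>C class_coeff G j)"
    using q unfolding J_def c_def Q_def by blast+
  define w where "w f = (\<lambda>y. if y \<in> ?X then \<Prod>i\<in>?J. class_coeff G (f i) (y i) else 0)" for f
  define \<sigma> where "\<sigma> f = (\<lambda>i\<in>?J. fst (f i))" for f :: "nat \<Rightarrow> ('g, nat) rep set \<times> nat \<times> nat"
  show ?thesis
  proof (rule that[of "PiE ?J J" "\<lambda>f. \<Prod>i\<in>?J. c i (f i)" w \<sigma>])
    show "finite (PiE ?J J)"
      by (intro finite_PiE) (auto intro: J)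
    show "ket x = (\<Sum>f\<in>PiE ?J J. (\<Prod>i\<in>?J. c i (f i)) *\<^sub>C w f)"
    proof
      fix y
      show "ket x y = (\<Sum>f\<in>PiE ?J J. (\<Prod>i\<in>?J. c i (f i)) *\<^sub>C w f) y"
      proof (cases "y \<in> ?X")
        case True
        have "(\<Sum>f\<in>PiE ?J J. (\<Prod>i\<in>?J. c i (f i)) *\<^sub>C w f) y
            = (\<Sum>f\<in>PiE ?J J. \<Prod>i\<in>?J. c i (f i) * class_coeff G (f i) (y i))"
          using True by (simp add: vect_apply w_def prod.distrib)
        also have "\<dots> = (\<Prod>i\<in>?J. \<Sum>j\<in>J i. c i j * class_coeff G j (y i))"
          by (rule prod_sum_PiE[symmetric]) (auto intro: J)
        also have "\<dots> = (\<Prod>i\<in>?J. ket (x i) (y i))"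
          by (rule prod.cong) (simp_all add: c vect_apply)
        also have "\<dots> = ket x y"
        proof (cases "x = y")
          case False
          then obtain i where "i \<in> ?J" "x i \<noteq> y i"
            using x True unfolding power_group_carrier by (meson PiE_ext)
          then show ?thesis
            using False by (auto simp: ket_def intro!: prod_zero)
        qed (simp add: ket_def)
        finally show ?thesis by simp
      next
        case False
        then show ?thesis
          using x by (auto simp: vect_apply w_def ket_def)
      qed
    qed
    show "\<forall>f\<in>PiE ?J J. \<sigma> f \<in> ?J \<rightarrow>\<^sub>E unitary_dual G \<and> w f \<in> weak_space G k (\<sigma> f)"
    proof
      fix f assume f: "f \<in> PiE ?J J"
      have fi: "f i \<in> coeff_index G" if "i \<in> ?J" for i
        using f J(2) that by blast
      have \<sigma>: "\<sigma> f \<in> ?J \<rightarrow>\<^sub>E unitary_dual G"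
        using fi by (force simp: \<sigma>_def coeff_index_def)
      define a where "a = (\<lambda>i\<in>?J. fst (snd (f i)))"
      define b where "b = (\<lambda>i\<in>?J. snd (snd (f i)))"
      have ab: "a \<in> PiE ?J (\<lambda>i. fst (class_rep (\<sigma> f i)))" "b \<in> PiE ?J (\<lambda>i. fst (class_rep (\<sigma> f i)))"
        using fi by (force simp: a_def b_def \<sigma>_def coeff_index_def)+
      have "w f = (\<lambda>y. if y \<in> ?X then \<Prod>i\<in>?J. matrix_coeff G (class_rep (\<sigma> f i)) (a i) (b i) (y i) else 0)"
        by (auto simp: w_def fun_eq_iff a_def b_def \<sigma>_def class_coeff_def split_beta intro!: prod.cong)
      also have "\<dots> \<in> weak_space G k (\<sigma> f)"
        using \<sigma> by (intro product_coeff_isotypic G ab class_rep_irrep) auto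
      finally show "\<sigma> f \<in> ?J \<rightarrow>\<^sub>E unitary_dual G \<and> w f \<in> weak_space G k (\<sigma> f)"
        using \<sigma> by blast
    qed
  qed
qed

lemma weak_space_in_image:
  assumes "finite (carrier G)" and "v \<in> weak_space G k \<sigma>"
  shows "v \<in> weak_proj G k \<sigma> ` hilb (carrier (power_group G k))"
proof
  have sub: "weak_space G k \<sigma> \<subseteq> hilb (carrier (power_group G k))"
    by (rule isotypic_subset[OF subspace_hilb])
  show "v = weak_proj G k \<sigma> v"
    unfolding weak_proj_def
    by (rule orth_proj_in_subspace[OF power_group_finite[OF assms(1)] isotypic_subspace sub assms(2), symmetric])
  show "v \<in> hilb (carrier (power_group G k))"
    using sub assms(2) by auto
qed

text \<open>The vector is \<open>\<eta>\<close>-isotypic by construction. It stays in the weak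
  sampling space because the diagonal action runs through elements of the power group, under which
  that space is invariant.\<close>

lemma transfer_map_W_span:
  assumes G: "group G" "finite (carrier G)" and irr: "irrep G (B, \<eta>)" and u: "u \<in> hilb B"
    and I: "I \<subseteq> {1..k}" "I \<noteq> {}" and v: "v \<in> weak_space G k \<sigma>"
  shows "transfer_map G \<eta> (diag_right_mult G k I) a v u \<in> W_span G k (B, \<eta>) \<sigma>"
proof -
  interpret group G by (rule G(1))
  let ?t = "transfer_map G \<eta> (diag_right_mult G k I) a v u"
  have vX: "v \<in> hilb (carrier (power_group G k))"
    using v isotypic_subset[OF subspace_hilb] by blast
  have "diag_right_mult G k I g v \<in> weak_space G k \<sigma>" if g: "g \<in> carrier G" for g
    using isotypic_invariant[OF right_mult_action[OF G] diag_embed_closed[OF G(1) g] v]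
    by (simp add: diag_right_mult_eq[OF G g] right_mult_eq[OF G diag_embed_closed[OF G(1) g]])
  then have "?t \<in> weak_space G k \<sigma>"
    unfolding transfer_map_def
    by (intro cvs.subspace_sum[OF isotypic_subspace] cvs.subspace_scale[OF isotypic_subspace]) simp
  moreover have "?t \<in> isotypic G (hilb (carrier (power_group G k))) (diag_right_mult G k I) (B, \<eta>)"
    by (rule transfer_map_isotypic[OF G(1) irr diag_right_mult_action[OF G] vX u])
  ultimately have "?t \<in> W_reg G k (B, \<eta>) \<sigma> I"
    unfolding W_reg_def using weak_space_in_image[OF G(2)] by blast
  then show ?thesis
    unfolding W_span_def using I by (blast intro: cvs.span_base)
qed

section \<open>The dimension bound\<close>

lemma orthonormal_sum_squares:
  assumes "orthonormal X E" and "e \<in> E"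
  shows "(\<Sum>x\<in>X. (cmod (e x))\<^sup>2) = 1"
proof -
  have "complex_of_real (\<Sum>x\<in>X. (cmod (e x))\<^sup>2) = 1"
    using assms unfolding cinner_self[symmetric] by (simp add: orthonormal_def)
  then show ?thesis by (rule of_real_eq_1_iff[THEN iffD1])
qed

text \<open>Read \<open>F x\<close> as column \<open>x\<close> of an operator with image in
  \<open>W\<close>. Expanding the columns in an orthonormal basis \<open>E\<close> of
  \<open>W\<close> writes the trace as a sum over pairs \<open>(x, e)\<close>. Cauchy-Schwarz then
  leaves the factor \<open>card E\<close>, which is the dimension, and a factor bounded by Bessel's
  inequality.\<close>

lemma trace_sq_le_dim:
  assumes X: "finite X" and W: "cvs.subspace W" "W \<subseteq> hilb X" and F: "\<And>x. x \<in> X \<Longrightarrow> F x \<in> W"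
  shows "(cmod (\<Sum>x\<in>X. F x x))\<^sup>2 \<le> real (cvs.dim W) * (\<Sum>x\<in>X. \<Sum>y\<in>X. (cmod (F x y))\<^sup>2)"
proof -
  obtain E where E: "orthonormal X E" "cvs.span E = W" "E \<subseteq> W"
    using onb_exists[OF X W] .
  let ?p = "\<lambda>(x, e). cmod (cinner X e (F x))" and ?q = "\<lambda>(x, e). cmod (e x)"
  have "F x x = (\<Sum>e\<in>E. cinner X e (F x) * e x)" if "x \<in> X" for x
  proof -
    have "expansion X E (F x) = F x"
      using E F[OF that] W(2) by (intro expansion_id[OF X]) auto
    then show ?thesis
      by (metis (no_types, lifting) expansion_def sum_fun_apply cscale_apply sum.cong)
  qed
  then have "(\<Sum>x\<in>X. F x x) = (\<Sum>(x, e)\<in>X \<times> E. cinner X e (F x) * e x)"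
    by (simp add: sum.cartesian_product)
  also have "cmod \<dots> \<le> (\<Sum>i\<in>X \<times> E. ?p i * ?q i)"
    by (rule order_trans[OF norm_sum]) (simp add: split_beta norm_mult)
  finally have "(cmod (\<Sum>x\<in>X. F x x))\<^sup>2 \<le> (\<Sum>i\<in>X \<times> E. ?p i * ?q i)\<^sup>2"
    by (rule power_mono) simp
  also have "\<dots> \<le> (\<Sum>i\<in>X \<times> E. (?p i)\<^sup>2) * (\<Sum>i\<in>X \<times> E. (?q i)\<^sup>2)"
    by (rule Cauchy_Schwarz_ineq_sum)
  also have "(\<Sum>i\<in>X \<times> E. (?q i)\<^sup>2) = (\<Sum>x\<in>X. \<Sum>e\<in>E. (cmod (e x))\<^sup>2)"
    by (simp add: sum.cartesian_product split_beta)
  also have "\<dots> = (\<Sum>e\<in>E. \<Sum>x\<in>X. (cmod (e x))\<^sup>2)"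
    by (rule sum.swap)
  also have "\<dots> = real (cvs.dim W)"
    using dim_onb[OF E(1)] E(2) by (simp add: orthonormal_sum_squares[OF E(1)])
  also have "(\<Sum>i\<in>X \<times> E. (?p i)\<^sup>2) = (\<Sum>x\<in>X. \<Sum>e\<in>E. (cmod (cinner X e (F x)))\<^sup>2)"
    by (simp add: sum.cartesian_product split_beta)
  also have "\<dots> * real (cvs.dim W) \<le> (\<Sum>x\<in>X. \<Sum>y\<in>X. (cmod (F x y))\<^sup>2) * real (cvs.dim W)"
    by (intro mult_right_mono sum_mono bessel[OF E(1)]) simp
  finally show ?thesis
    by (simp add: mult.commute)
qed

text \<open>By unitarity \<open>\<eta> g (ket a)\<close> is a unit vector, so none of its
  coordinates exceeds 1 in modulus.\<close>

lemma irrep_diag_coeff_le_1: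
  assumes "irrep G (B, \<eta>)" and "a \<in> B" and "g \<in> carrier G"
  shows "cmod (\<eta> g (ket a) a) \<le> 1"
proof -
  note fin = irrep_finite[OF assms(1)]
  have "complex_of_real (\<Sum>y\<in>B. (cmod (\<eta> g (ket a) y))\<^sup>2) = 1"
    unfolding cinner_self[symmetric] irrep_unitary[OF assms(1,3) ket_in_hilb[OF assms(2)] ket_in_hilb[OF assms(2)]]
    using cinner_ket[OF fin assms(2)] by (simp add: ket_def)
  then have "(\<Sum>y\<in>B. (cmod (\<eta> g (ket a) y))\<^sup>2) = 1"
    by (rule of_real_eq_1_iff[THEN iffD1])
  moreover have "(cmod (\<eta> g (ket a) a))\<^sup>2 \<le> (\<Sum>y\<in>B. (cmod (\<eta> g (ket a) y))\<^sup>2)"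
    using assms(2) fin by (intro member_le_sum) auto
  ultimately show ?thesis
    by (simp add: power_le_one_iff abs_square_le_1)
qed

section \<open>The operators of the trace argument\<close>

lemma diag_embed_eq_iff:
  assumes "group G" and "I \<subseteq> {1..k}" and "I \<noteq> {}" and "g \<in> carrier G" and "h \<in> carrier G"
  shows "diag_embed G k I g = diag_embed G k I h \<longleftrightarrow> g = h"
proof
  assume eq: "diag_embed G k I g = diag_embed G k I h"
  obtain i where "i \<in> I" using assms(3) by auto
  then show "g = h"
    using fun_cong[OF eq, of i] assms(2) by (auto simp: diag_embed_def)
qed simp

text \<open>A register that lies in exactly one of \<open>I\<close> and \<open>J\<close> forces one
  of the elements to be the identity; a register of the other set then forces the other element.
  This makes the operators of distinct register sets overlap as little as possible.\<close>

lemma diag_embed_neq_iff: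
  assumes "group G" and "I \<subseteq> {1..k}" and "I \<noteq> {}" and "J \<subseteq> {1..k}" and "J \<noteq> {}" and "I \<noteq> J"
    and "g \<in> carrier G" and "h \<in> carrier G"
  shows "diag_embed G k I g = diag_embed G k J h \<longleftrightarrow> g = \<one>\<^bsub>G\<^esub> \<and> h = \<one>\<^bsub>G\<^esub>"
proof
  assume eq: "diag_embed G k I g = diag_embed G k J h"
  have eqi: "(if i \<in> I then g else \<one>\<^bsub>G\<^esub>) = (if i \<in> J then h else \<one>\<^bsub>G\<^esub>)" if "i \<in> {1..k}" for i
    using fun_cong[OF eq, of i] that by (simp add: diag_embed_def)
  have one: "g = \<one>\<^bsub>G\<^esub> \<or> h = \<one>\<^bsub>G\<^esub>"
  proof -
    obtain i where "i \<in> {1..k}" "(i \<in> I) \<noteq> (i \<in> J)"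
      using assms(2,4,6) by blast
    then show ?thesis
      using eqi[of i] by (auto split: if_splits)
  qed
  obtain i j where "i \<in> I" "j \<in> J" using assms(3,5) by auto
  then show "g = \<one>\<^bsub>G\<^esub> \<and> h = \<one>\<^bsub>G\<^esub>"
    using one eqi[of i] eqi[of j] assms(2,4) by (auto split: if_splits)
qed (simp add: diag_embed_one)

text \<open>The inverse in \<open>transfer_map\<close> cancels the one in right multiplication. With
  \<open>u = ket a\<close> this is the operator \<open>A\<^sub>I\<close> of the trace
  argument.\<close>

lemma transfer_map_ket:
  assumes G: "group G" "finite (carrier G)" and x: "x \<in> carrier (power_group G k)"
  shows "transfer_map G \<eta> (diag_right_mult G k I) a (ket x) u =
    (\<Sum>g\<in>carrier G. \<eta> g u a *\<^sub>C ket (x \<otimes>\<^bsub>power_group G k\<^esub> diag_embed G k I g))"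
  unfolding transfer_map_def
proof (rule sum.cong)
  fix g assume g: "g \<in> carrier G"
  interpret group G by (rule G(1))
  interpret P: group "power_group G k" by (rule power_group_group[OF G(1)])
  have "diag_embed G k I g \<otimes>\<^bsub>power_group G k\<^esub> diag_embed G k I (inv\<^bsub>G\<^esub> g) = \<one>\<^bsub>power_group G k\<^esub>"
    using g by (simp add: diag_embed_mult[OF G(1), symmetric] diag_embed_one)
  then have "inv\<^bsub>power_group G k\<^esub> (diag_embed G k I (inv\<^bsub>G\<^esub> g)) = diag_embed G k I g"
    using g by (intro P.inv_equality) (simp_all add: diag_embed_closed[OF G(1)])
  then show "\<eta> g u a *\<^sub>C diag_right_mult G k I (inv\<^bsub>G\<^esub> g) (ket x) =
      \<eta> g u a *\<^sub>C ket (x \<otimes>\<^bsub>power_group G k\<^esub> diag_embed G k I g)"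
    using g right_regular_ket[OF P.is_group diag_embed_closed[OF G(1) inv_closed[OF g]] x, of I]
    by (simp add: diag_right_mult_eq[OF G])
qed simp

text \<open>The link between the two dimension estimates: the trace inequality bounds its dimension
  from below, the sum of the dimensions of the \<open>W_span\<close> bounds it from above.\<close>

definition W_total ::
    "('g, 'm) monoid_scheme \<Rightarrow> nat \<Rightarrow> ('g, 'i) rep \<Rightarrow> (nat \<Rightarrow> 'g) vect set"
  where "W_total G k \<eta> = cvs.span (\<Union>\<sigma>\<in>{1..k} \<rightarrow>\<^sub>E unitary_dual G. W_span G k \<eta> \<sigma>)"

text \<open>The transfer map is linear in the vector being moved, so it may be applied termwise to
  the decomposition of \<open>ket x\<close> over the weak sampling spaces.\<close>

lemma transfer_map_W_total:
  fixes G :: "('g, 'm) monoid_scheme"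
  assumes G: "group G" "finite (carrier G)" and irr: "irrep G (B, \<eta>)" and u: "u \<in> hilb B"
    and I: "I \<subseteq> {1..k}" "I \<noteq> {}" and x: "x \<in> carrier (power_group G k)"
  shows "transfer_map G \<eta> (diag_right_mult G k I) a (ket x) u \<in> W_total G k (B, \<eta>)"
proof -
  interpret group G by (rule G(1))
  obtain F and c :: "(nat \<Rightarrow> ('g, nat) rep set \<times> nat \<times> nat) \<Rightarrow> complex" and w \<sigma>
    where F: "finite F" "ket x = (\<Sum>f\<in>F. c f *\<^sub>C w f)"
    and w: "\<forall>f\<in>F. \<sigma> f \<in> {1..k} \<rightarrow>\<^sub>E unitary_dual G \<and> w f \<in> weak_space G k (\<sigma> f)"
    using ket_weak_decomposition[OF G x] .
  let ?t = "\<lambda>v. transfer_map G \<eta> (diag_right_mult G k I) a v u"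
  have lin: "clin ?t"
    unfolding transfer_map_def
  proof (rule clin_sumI)
    fix g assume g: "g \<in> carrier G"
    have D: "clin (diag_right_mult G k I (inv\<^bsub>G\<^esub> g))"
      by (rule actionD(2)[OF diag_right_mult_action[OF G] inv_closed[OF g]])
    show "clin (\<lambda>v. \<eta> g u a *\<^sub>C diag_right_mult G k I (inv\<^bsub>G\<^esub> g) v)"
      by (rule clinI) (simp_all add: clin_add[OF D] clin_scale[OF D] cvs.scale_right_distrib mult.commute)
  qed
  have "?t (ket x) = (\<Sum>f\<in>F. c f *\<^sub>C ?t (w f))"
    unfolding F(2) clin_sum[OF lin] clin_scale[OF lin] ..
  also have "\<dots> \<in> W_total G k (B, \<eta>)"
    unfolding W_total_def
  proof (intro cvs.span_sum cvs.span_scale cvs.span_base)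
    fix f assume f: "f \<in> F"
    have "?t (w f) \<in> W_span G k (B, \<eta>) (\<sigma> f)"
      using bspec[OF w f] by (intro transfer_map_W_span[OF G irr u I]) simp
    then show "?t (w f) \<in> (\<Union>\<sigma>\<in>{1..k} \<rightarrow>\<^sub>E unitary_dual G. W_span G k (B, \<eta>) \<sigma>)"
      using bspec[OF w f] by blast
  qed
  finally show ?thesis .
qed

lemma W_total_subset: "W_total G k \<eta> \<subseteq> hilb (carrier (power_group G k))"
  unfolding W_total_def
  by (rule cvs.span_minimal[OF _ subspace_hilb]) (use W_span_subset in blast)

text \<open>Reduces the Hilbert-Schmidt products below to counting coincidences
  \<open>p g = q h\<close>.\<close>

lemma sum_ket_cinner:
  assumes "finite X" and "\<And>g. g \<in> A \<Longrightarrow> p g \<in> X" and "\<And>h. h \<in> B \<Longrightarrow> q h \<in> X"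
  shows "cinner X (\<Sum>g\<in>A. c g *\<^sub>C ket (p g)) (\<Sum>h\<in>B. d h *\<^sub>C ket (q h)) =
    (\<Sum>g\<in>A. \<Sum>h\<in>B. if p g = q h then cnj (c g) * d h else 0)"
proof -
  have "cinner X (ket (p g)) (ket (q h)) = (if p g = q h then 1 else 0)" if "g \<in> A" for g h
    using cinner_ket[OF assms(1) assms(2)[OF that]] by (simp add: ket_def)
  then show ?thesis
    unfolding cinner_sum_left
    by (auto simp: cinner_sum_right cinner_scale_left cinner_scale_right sum_distrib_left intro!: sum.cong)
qed

lemma dim_W_total:
  fixes \<eta> :: "'g \<Rightarrow> 'i oper" and G :: "('g, 'm) monoid_scheme"
  assumes G: "group G" "finite (carrier G)" and irr: "irrep G (B, \<eta>)"
    and k: "k \<ge> 1" "order G \<le> 2 ^ k"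
  shows "order G ^ k \<le> 2 * cvs.dim (W_total G k (B, \<eta>))"
proof -
  interpret group G by (rule G(1))
  let ?P = "power_group G k"
  let ?X = "carrier ?P" and ?W = "W_total G k (B, \<eta>)"
  interpret P: group ?P by (rule power_group_group[OF G(1)])
  have finX: "finite ?X" by (rule power_group_finite[OF G(2)])
  have cardX: "card ?X = order G ^ k"
    by (simp add: power_group_carrier card_PiE order_def)
  obtain a where a: "a \<in> B" using irrep_nonempty[OF irr] by auto
  define c where "c g = \<eta> g (ket a) a" for g
  have c1: "c \<one>\<^bsub>G\<^esub> = 1"
    using actionD(4)[OF irrep_action[OF irr] ket_in_hilb[OF a]] by (simp add: c_def ket_def)
  define \<I> where "\<I> = {I. I \<subseteq> {1..k} \<and> I \<noteq> {}}"
  have finI: "finite \<I>" and cardI: "card \<I> = 2 ^ k - 1"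
  proof -
    have "\<I> = Pow {1..k} - {{}}" by (auto simp: \<I>_def)
    then show "finite \<I>" "card \<I> = 2 ^ k - 1" by (simp_all add: card_Pow)
  qed
  define M where "M = card \<I>"
  \<comment> \<open>Since \<open>M\<close> is \<open>2 ^ k - 1\<close>, the bound
    \<open>order G \<le> 2 ^ k\<close> reads \<open>order G \<le> M + 1\<close>, and
    \<open>k \<ge> 1\<close> makes \<open>M\<close> positive.\<close>
  have M1: "M \<ge> 1" and M2: "order G \<le> M + 1"
    using k cardI one_le_power[of "2::nat" k] power_increasing[OF k(1), of "2::nat"]
    unfolding M_def by auto
  define e where "e I g = diag_embed G k I g" for I g
  have eX: "x \<otimes>\<^bsub>?P\<^esub> e I g \<in> ?X" if "x \<in> ?X" "g \<in> carrier G" for x I g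
    using that by (simp add: e_def diag_embed_closed[OF G(1)])
  define A where "A I x = (\<Sum>g\<in>carrier G. c g *\<^sub>C ket (x \<otimes>\<^bsub>?P\<^esub> e I g))" for I x
  define F where "F x = (\<Sum>I\<in>\<I>. A I x)" for x
  have FW: "F x \<in> ?W" if x: "x \<in> ?X" for x
    unfolding F_def
  proof (rule cvs.subspace_sum)
    show "cvs.subspace ?W"
      unfolding W_total_def by (rule cvs.subspace_span)
    fix I assume "I \<in> \<I>"
    then have "transfer_map G \<eta> (diag_right_mult G k I) a (ket x) (ket a) \<in> ?W"
      by (intro transfer_map_W_total[OF G irr ket_in_hilb[OF a] _ _ x]) (auto simp: \<I>_def)
    then show "A I x \<in> ?W"
      unfolding transfer_map_ket[OF G x] A_def c_def e_def .
  qed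
  \<comment> \<open>Right multiplication by \<open>e I g\<close> fixes \<open>x\<close> only for the
    identity, where \<open>c\<close> has value 1, so each of the \<open>M\<close> operators
    contributes 1.\<close>
  have trace: "F x x = of_nat M" if x: "x \<in> ?X" for x
  proof -
    have "A I x x = 1" if I: "I \<in> \<I>" for I
    proof -
      have "x = x \<otimes>\<^bsub>?P\<^esub> e I g \<longleftrightarrow> g = \<one>\<^bsub>G\<^esub>" if g: "g \<in> carrier G" for g
      proof -
        have "x = x \<otimes>\<^bsub>?P\<^esub> e I g \<longleftrightarrow> e I g = e I \<one>\<^bsub>G\<^esub>"
          using x g P.l_cancel_one'[of x "e I g"] by (simp add: e_def diag_embed_closed[OF G(1)] diag_embed_one)
        then show ?thesis
          using I g diag_embed_eq_iff[OF G(1), of I k g "\<one>\<^bsub>G\<^esub>"] by (simp add: \<I>_def e_def)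
      qed
      then have "A I x x = (\<Sum>g\<in>carrier G. if g = \<one>\<^bsub>G\<^esub> then c g else 0)"
        unfolding A_def by (auto simp: vect_apply ket_def intro!: sum.cong)
      then show ?thesis
        using G(2) c1 by simp
    qed
    then show ?thesis
      by (simp add: F_def vect_apply M_def)
  qed
  define s where "s = (\<Sum>g\<in>carrier G. (cmod (c g))\<^sup>2)"
  have s_le: "s \<le> real (order G)"
  proof -
    have "s \<le> (\<Sum>g\<in>carrier G. 1)"
      unfolding s_def c_def
      by (intro sum_mono power_le_one irrep_diag_coeff_le_1[OF irr a]) auto
    then show ?thesis by (simp add: order_def)
  qed
  \<comment> \<open>Every column has the same squared norm: the \<open>M\<close> pairs with
    \<open>I = J\<close> contribute \<open>s\<close> each, and the \<open>M * (M - 1)\<close> other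
    pairs contribute 1 each, from the identity alone.\<close>
  have norm: "(\<Sum>y\<in>?X. (cmod (F x y))\<^sup>2) = real M * (s + (real M - 1))" if x: "x \<in> ?X" for x
  proof -
    have AA: "cinner ?X (A I x) (A J x) = (if I = J then of_real s else 1)"
      if IJ: "I \<in> \<I>" "J \<in> \<I>" for I J
    proof -
      have eq: "x \<otimes>\<^bsub>?P\<^esub> e I g = x \<otimes>\<^bsub>?P\<^esub> e J h \<longleftrightarrow> e I g = e J h"
        if "g \<in> carrier G" "h \<in> carrier G" for g h
        using that x by (simp add: e_def diag_embed_closed[OF G(1)])
      have "cinner ?X (A I x) (A J x)
          = (\<Sum>g\<in>carrier G. \<Sum>h\<in>carrier G. if x \<otimes>\<^bsub>?P\<^esub> e I g = x \<otimes>\<^bsub>?P\<^esub> e J h then cnj (c g) * c h else 0)"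
        unfolding A_def by (rule sum_ket_cinner[OF finX]) (auto intro: eX[OF x])
      also have "\<dots> = (\<Sum>g\<in>carrier G. \<Sum>h\<in>carrier G. if e I g = e J h then cnj (c g) * c h else 0)"
        by (intro sum.cong refl) (simp add: eq)
      also have "\<dots> = (if I = J then of_real s else 1)"
      proof (cases "I = J")
        case True
        have "(\<Sum>g\<in>carrier G. \<Sum>h\<in>carrier G. if e I g = e J h then cnj (c g) * c h else 0)
            = (\<Sum>g\<in>carrier G. \<Sum>h\<in>carrier G. if h = g then cnj (c g) * c h else 0)"
          using IJ True diag_embed_eq_iff[OF G(1), of I k]
          by (intro sum.cong refl) (auto simp: e_def \<I>_def)
        also have "\<dots> = of_real s"
          using G(2) by (simp add: s_def cnj_mult_self)
        finally show ?thesis using True by simp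
      next
        case False
        have "(\<Sum>g\<in>carrier G. \<Sum>h\<in>carrier G. if e I g = e J h then cnj (c g) * c h else 0)
            = (\<Sum>g\<in>carrier G. \<Sum>h\<in>carrier G. if h = \<one>\<^bsub>G\<^esub> then (if g = \<one>\<^bsub>G\<^esub> then 1 else 0) else 0)"
          using IJ False diag_embed_neq_iff[OF G(1), of I k J] c1
          by (intro sum.cong refl) (auto simp: e_def \<I>_def)
        also have "\<dots> = 1"
          using G(2) by simp
        finally show ?thesis using False by simp
      qed
      finally show ?thesis .
    qed
    have "complex_of_real (\<Sum>y\<in>?X. (cmod (F x y))\<^sup>2) = (\<Sum>I\<in>\<I>. \<Sum>J\<in>\<I>. if J = I then of_real s else 1)"
      unfolding cinner_self[symmetric] F_def cinner_sum_left cinner_sum_right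
      by (intro sum.cong refl) (auto simp: AA)
    also have "\<dots> = (\<Sum>I\<in>\<I>. of_real (s + (real M - 1)))"
    proof (rule sum.cong)
      fix I assume I: "I \<in> \<I>"
      have "(\<Sum>J\<in>\<I>. if J = I then of_real s else 1) = complex_of_real s + (\<Sum>J\<in>\<I> - {I}. 1)"
        unfolding sum.remove[OF finI I] by (auto intro!: sum.cong)
      also have "\<dots> = of_real (s + (real M - 1))"
        using I finI M1 by (simp add: M_def of_nat_diff)
      finally show "(\<Sum>J\<in>\<I>. if J = I then of_real s else 1) = complex_of_real (s + (real M - 1))" .
    qed simp
    also have "\<dots> = of_real (real M * (s + (real M - 1)))"
      by (simp add: M_def)
    finally show ?thesis
      unfolding of_real_eq_iff .
  qed
  define N where "N = card ?X"
  define d where "d = cvs.dim ?W"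
  have "cmod (\<Sum>x\<in>?X. F x x) = real N * real M"
    by (simp add: trace N_def norm_mult)
  moreover have "cvs.subspace ?W"
    unfolding W_total_def by (rule cvs.subspace_span)
  ultimately have "(real N * real M)\<^sup>2 \<le> real d * (real N * (real M * (s + (real M - 1))))"
    using trace_sq_le_dim[of ?X ?W F] finX FW
      W_total_subset[of G k "(B, \<eta>)"] by (simp add: norm N_def d_def)
  also have "\<dots> \<le> real d * (real N * (real M * (2 * real M)))"
  proof -
    \<comment> \<open>From \<open>s \<le> order G \<le> M + 1\<close>; this factor 2 is the source
      of the probability one half.\<close>
    have "s + (real M - 1) \<le> 2 * real M"
      using s_le M2 by linarith
    then show ?thesis
      by (intro mult_left_mono) auto
  qed
  finally have "(real N * (real M)\<^sup>2) * real N \<le> (real N * (real M)\<^sup>2) * (2 * real d)"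
    by (simp add: power2_eq_square algebra_simps)
  moreover have "N > 0"
    using finX P.one_closed unfolding N_def card_gt_0_iff by blast
  ultimately have "real N \<le> 2 * real d"
    using M1 by (subst (asm) mult_le_cancel_left_pos) auto
  then show ?thesis
    using cardX unfolding N_def d_def by linarith
qed

section \<open>The probability for the trivial subgroup\<close>

text \<open>For the trivial subgroup the coset states are the basis vectors themselves, so the state
  is maximally mixed.\<close>

lemma trivial_coset_density_power:
  assumes G: "group G" "finite (carrier G)" and x: "x \<in> carrier (power_group G k)"
  shows "coset_density_power G k {\<one>\<^bsub>G\<^esub>} (ket x) = (1 / of_nat (order G ^ k)) *\<^sub>C ket x"
proof
  interpret group G by (rule G(1))
  let ?X = "carrier (power_group G k)"
  have state: "coset_state G {\<one>\<^bsub>G\<^esub>} c = ket c" if "c \<in> carrier G" for c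
    using that by (simp add: coset_state_def)
  have entry: "coset_density G {\<one>\<^bsub>G\<^esub>} (ket y) z = (if z = y then 1 / of_nat (order G) else 0)"
    if "y \<in> carrier G" for y z
  proof -
    have "(\<Sum>c\<in>carrier G. ketbra (carrier G) (coset_state G {\<one>\<^bsub>G\<^esub>} c) (coset_state G {\<one>\<^bsub>G\<^esub>} c) (ket y) z)
        = (\<Sum>c\<in>carrier G. if c = y then ket y z else 0)"
      by (rule sum.cong)
        (simp_all add: state ketbra_def cinner_ket[OF G(2)] vect_apply, auto simp: ket_def)
    then show ?thesis
      using that G(2) by (simp add: coset_density_def vect_apply ket_def)
  qed
  fix y
  show "coset_density_power G k {\<one>\<^bsub>G\<^esub>} (ket x) y = ((1 / of_nat (order G ^ k)) *\<^sub>C ket x) y"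
  proof (cases "y \<in> ?X")
    case True
    have xG: "x i \<in> carrier G" if "i \<in> {1..k}" for i
      using x that by (auto simp: power_group_carrier)
    have "coset_density_power G k {\<one>\<^bsub>G\<^esub>} (ket x) y
        = (\<Sum>b\<in>?X. if b = x then \<Prod>i\<in>{1..k}. coset_density G {\<one>\<^bsub>G\<^esub>} (ket (b i)) (y i) else 0)"
      using True unfolding coset_density_power_def tensor_op_def power_group_carrier
      by (auto simp: ket_def intro!: sum.cong)
    also have "\<dots> = (\<Prod>i\<in>{1..k}. if y i = x i then 1 / of_nat (order G) else 0)"
      using x power_group_finite[OF G(2), of k] by (simp add: entry xG)
    also have "\<dots> = (if y = x then (1 / of_nat (order G)) ^ k else 0)"
    proof (cases "y = x")
      case False
      then obtain i where "i \<in> {1..k}" "y i \<noteq> x i"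
        using x True unfolding power_group_carrier by (meson PiE_ext)
      then show ?thesis
        using False by (auto intro!: prod_zero)
    qed simp
    finally show ?thesis
      by (simp add: vect_apply ket_def power_one_over)
  next
    case False
    then show ?thesis
      using x by (auto simp: coset_density_power_def tensor_op_def power_group_carrier vect_apply ket_def)
  qed
qed

text \<open>Against the maximally mixed state, each projection contributes its trace divided by the
  dimension of the space, and the trace of a projection is the dimension of its image.\<close>

lemma prob_trivial_trivial_subgroup:
  assumes G: "group G" "finite (carrier G)"
  shows "prob_trivial G k \<eta> (coset_density_power G k {\<one>\<^bsub>G\<^esub>}) =
    of_nat (\<Sum>\<sigma>\<in>{1..k} \<rightarrow>\<^sub>E unitary_dual G. cvs.dim (W_span G k \<eta> \<sigma>)) / of_nat (order G ^ k)"
proof -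
  let ?X = "carrier (power_group G k)" and ?N = "of_nat (order G ^ k) :: complex"
  have finX: "finite ?X" by (rule power_group_finite[OF G(2)])
  have "op_trace ?X (Proj_W G k \<eta> \<sigma> \<circ> coset_density_power G k {\<one>\<^bsub>G\<^esub>})
      = of_nat (cvs.dim (W_span G k \<eta> \<sigma>)) / ?N" for \<sigma>
  proof -
    let ?W = "W_span G k \<eta> \<sigma>"
    have W: "cvs.subspace ?W"
      unfolding W_span_def by (rule cvs.subspace_span)
    obtain E where E: "orthonormal ?X E" "cvs.span E = ?W"
      using onb_exists[OF finX W W_span_subset] by blast
    have "op_trace ?X (Proj_W G k \<eta> \<sigma> \<circ> coset_density_power G k {\<one>\<^bsub>G\<^esub>})
        = (\<Sum>x\<in>?X. expansion ?X E ((1 / ?N) *\<^sub>C ket x) x)"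
      unfolding op_trace_def o_def Proj_W_def
      by (rule sum.cong)
        (simp_all only: trivial_coset_density_power[OF G] orth_proj_onb[OF finX E W_span_subset])
    also have "\<dots> = (\<Sum>x\<in>?X. \<Sum>e\<in>E. (1 / ?N) * (cnj (e x) * e x))"
    proof (intro sum.cong refl)
      fix x assume x: "x \<in> ?X"
      have "cinner ?X e (ket x) = cnj (e x)" for e
        using cinner_ket[OF finX x, of e] cnj_cinner[of ?X "ket x" e] by simp
      then show "expansion ?X E ((1 / ?N) *\<^sub>C ket x) x = (\<Sum>e\<in>E. (1 / ?N) * (cnj (e x) * e x))"
        by (simp add: expansion_def vect_apply cinner_scale_right mult.assoc)
    qed
    also have "\<dots> = (\<Sum>e\<in>E. (1 / ?N) * cinner ?X e e)"
      by (subst sum.swap) (simp add: cinner_def sum_distrib_left)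
    also have "\<dots> = (\<Sum>e\<in>E. 1 / ?N)"
      using E(1) by (intro sum.cong) (auto simp: orthonormal_def)
    also have "\<dots> = of_nat (cvs.dim ?W) / ?N"
      using dim_onb[OF E(1)] E(2) by simp
    finally show ?thesis .
  qed
  then show ?thesis
    by (simp add: prob_trivial_def sum_divide_distrib)
qed

text \<open>Bases of the summands together span the total space, and the cardinality of a union is
  at most the sum of the cardinalities.\<close>

lemma dim_W_total_le:
  assumes G: "group G" "finite (carrier G)"
  shows "cvs.dim (W_total G k \<eta>) \<le> (\<Sum>\<sigma>\<in>{1..k} \<rightarrow>\<^sub>E unitary_dual G. cvs.dim (W_span G k \<eta> \<sigma>))"
proof -
  let ?D = "{1..k} \<rightarrow>\<^sub>E unitary_dual G"
  \<comment> \<open>A sum over an infinite index set is 0 by convention in HOL, so the bound depends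
    on the finiteness of the dual.\<close>
  have finD: "finite ?D"
    by (intro finite_PiE) (auto intro: finite_unitary_dual[OF G])
  have "\<exists>E. finite E \<and> cvs.span E = W_span G k \<eta> \<sigma> \<and> card E = cvs.dim (W_span G k \<eta> \<sigma>)" for \<sigma>
  proof -
    have W: "cvs.subspace (W_span G k \<eta> \<sigma>)"
      unfolding W_span_def by (rule cvs.subspace_span)
    obtain E where E: "orthonormal (carrier (power_group G k)) E" "cvs.span E = W_span G k \<eta> \<sigma>"
        "E \<subseteq> W_span G k \<eta> \<sigma>"
      using onb_exists[OF power_group_finite[OF G(2)] W W_span_subset] .
    then have "finite E" "card E = cvs.dim (W_span G k \<eta> \<sigma>)"
      using dim_onb[OF E(1)] by (simp_all add: orthonormal_def)
    then show ?thesis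
      using E(2) by blast
  qed
  then obtain E where E: "\<And>\<sigma>. finite (E \<sigma>)" "\<And>\<sigma>. cvs.span (E \<sigma>) = W_span G k \<eta> \<sigma>"
    "\<And>\<sigma>. card (E \<sigma>) = cvs.dim (W_span G k \<eta> \<sigma>)"
    by metis
  have "W_total G k \<eta> \<subseteq> cvs.span (\<Union>\<sigma>\<in>?D. E \<sigma>)"
    unfolding W_total_def E(2)[symmetric]
    by (rule cvs.span_minimal[OF _ cvs.subspace_span]) (auto intro: cvs.span_mono[THEN subsetD, rotated])
  then have "cvs.dim (W_total G k \<eta>) \<le> card (\<Union>\<sigma>\<in>?D. E \<sigma>)"
    using finD E(1) by (intro cvs.dim_le_card) auto
  also have "\<dots> \<le> (\<Sum>\<sigma>\<in>?D. card (E \<sigma>))"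
    by (rule card_UN_le[OF finD])
  finally show ?thesis
    by (simp add: E(3))
qed

theorem mainTheorem1:
  fixes G :: "('g, 'm) monoid_scheme"
    and H :: "'g set"
    and \<eta> :: "('g, 'i) rep"
    and k :: nat
  assumes "group G" and "finite (carrier G)"
    and "subgroup H G"
    and "missing_harmonic G H \<eta>"
    and "k \<ge> 1" and "real k \<ge> log 2 (real (order G))"
  shows "(\<forall>g\<in>carrier G.
            prob_trivial G k \<eta>
              (coset_density_power G k ((\<lambda>h. g \<otimes>\<^bsub>G\<^esub> h \<otimes>\<^bsub>G\<^esub> inv\<^bsub>G\<^esub> g) ` H)) = 0) \<and>
         prob_trivial G k \<eta> (coset_density_power G k {\<one>\<^bsub>G\<^esub>}) \<ge> 1 / 2"
proof (intro conjI ballI)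
  fix g assume "g \<in> carrier G"
  then show "prob_trivial G k \<eta>
      (coset_density_power G k ((\<lambda>h. g \<otimes>\<^bsub>G\<^esub> h \<otimes>\<^bsub>G\<^esub> inv\<^bsub>G\<^esub> g) ` H)) = 0"
    by (rule prob_trivial_conjugate[OF assms(1-4)])
next
  obtain B e where \<eta>: "\<eta> = (B, e)" by fastforce
  have irr: "irrep G (B, e)"
    using assms(4) by (simp add: missing_harmonic_def \<eta>)
  have pos: "order G > 0"
    using assms(1,2) group.is_monoid monoid.one_closed unfolding order_def card_gt_0_iff by blast
  have "real (order G) \<le> 2 powr real k"
    using assms(6) pos by (simp add: log_le_iff)
  then have "order G \<le> 2 ^ k"
    by (simp add: powr_realpow)
  then have "order G ^ k \<le> 2 * cvs.dim (W_total G k \<eta>)"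
    unfolding \<eta> by (rule dim_W_total[OF assms(1,2) irr assms(5)])
  also have "\<dots> \<le> 2 * (\<Sum>\<sigma>\<in>{1..k} \<rightarrow>\<^sub>E unitary_dual G. cvs.dim (W_span G k \<eta> \<sigma>))" (is "_ \<le> 2 * ?d")
    using dim_W_total_le[OF assms(1,2)] by simp
  finally have le: "order G ^ k \<le> 2 * ?d" .
  have "1 / 2 \<le> real ?d / real (order G ^ k)"
    using le pos by (simp add: field_simps del: of_nat_sum of_nat_power)
  \<comment> \<open>The inequality is lifted to the partial order on complex numbers, where both
    sides have imaginary part 0.\<close>
  then have "complex_of_real (1 / 2) \<le> complex_of_real (real ?d / real (order G ^ k))"
    by (simp add: less_eq_complex_def)
  then show "prob_trivial G k \<eta> (coset_density_power G k {\<one>\<^bsub>G\<^esub>}) \<ge> 1 / 2"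
    unfolding prob_trivial_trivial_subgroup[OF assms(1,2)] by simp
qed

end
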